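(* Let $A$ be a finite abelian group. Then $e(A,A)=1$ if and only if $|A| = 2^\delta p_1\cdots p_m$ for some distinct odd primes $p_1,\dots,p_m$ and some $\delta\in\{0,1,2\}$, where the product of odd primes is allowed to be empty ($m=0$).
   Context: All groups are finite. For a group $G$, $\mathrm{Perm}(G)$ denotes the symmetric group on the underlying set of $G$. The left regular representation is $\lambda:G\to\mathrm{Perm}(G)$, $\lambda(\sigma)=(\tau\mapsto\sigma\tau)$. A subgroup $R$ of $\mathrm{Perm}(G)$ is called regular if the map $R\to G$, $\eta\mapsto\eta(1_G)$, is bijective. For groups $G,N$ of the same order, $e(G,N)$ denotes the number of regular subgroups of $\mathrm{Perm}(G)$ which are isomorphic to $N$ and normalized by $\lambda(G)$. *)

theory Defs
  imports "HOL-Algebra.Algebra"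
begin

text \<open>
  Permutations of (the underlying set of) a group \<open>G\<close> are the elements of the library group
  \<open>BijGroup (carrier G)\<close>, i.e. functions that are \<open>undefined\<close> outside the carrier;
  this is why \<open>left_reg\<close> is restricted to the carrier.
\<close>

definition Perm :: "('a, 'm) monoid_scheme \<Rightarrow> ('a \<Rightarrow> 'a) monoid" where
  "Perm G = BijGroup (carrier G)"

definition left_reg :: "('a, 'm) monoid_scheme \<Rightarrow> 'a \<Rightarrow> ('a \<Rightarrow> 'a)" where
  "left_reg G \<sigma> = (\<lambda>\<tau> \<in> carrier G. \<sigma> \<otimes>\<^bsub>G\<^esub> \<tau>)"

definition regular_subgroup :: "('a, 'm) monoid_scheme \<Rightarrow> ('a \<Rightarrow> 'a) set \<Rightarrow> bool" where
  "regular_subgroup G R \<longleftrightarrow>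
     subgroup R (Perm G) \<and> bij_betw (\<lambda>\<eta>. \<eta> \<one>\<^bsub>G\<^esub>) R (carrier G)"

definition normalized_by_left_reg :: "('a, 'm) monoid_scheme \<Rightarrow> ('a \<Rightarrow> 'a) set \<Rightarrow> bool" where
  "normalized_by_left_reg G R \<longleftrightarrow> left_reg G ` carrier G \<subseteq> normalizer (Perm G) R"

definition e_count :: "('a, 'm) monoid_scheme \<Rightarrow> ('b, 'n) monoid_scheme \<Rightarrow> nat" where
  "e_count G N = card {R. regular_subgroup G R \<and> (Perm G)\<lparr>carrier := R\<rparr> \<cong> N \<and>
                          normalized_by_left_reg G R}"

end

theory Submission
  imports Defs "HOL-Number_Theory.Cong"
begin

text \<open>
  A regular subgroup \<open>R\<close> of the permutations of an abelian group \<open>A\<close> amounts to a second group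
  structure \<open>\<oplus>\<close> on the set of \<open>A\<close>, with the elements of \<open>R\<close> as its translations. If \<open>R\<close> is
  isomorphic to \<open>A\<close>, this structure is abelian, and \<open>R\<close> is normalized by the left translations of
  \<open>A\<close> exactly when each translation \<open>x \<mapsto> a \<otimes> x\<close> of \<open>A\<close> is affine for \<open>\<oplus>\<close>. Then the two structures
  form a commutative brace, and \<open>a \<star> x\<close>, defined by \<open>a \<otimes> x = a \<oplus> x \<oplus> a \<star> x\<close>, is a commutative,
  associative, biadditive product; so \<open>A\<close> is the adjoint group of a commutative ring. Since the
  adjoint operation is a group operation, the equation \<open>a \<star> x = x\<close> forces \<open>x = \<zero>\<close>, and finiteness
  makes the product nilpotent (\<open>star_nilpotent\<close>).

  Suppose that no square of an odd prime and not the number 8 divides the order of \<open>A\<close>. The product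
  respects the primary components. On a component of prime order a nilpotent product vanishes. On a
  component of order 4 there are nonzero nilpotent products, but each of them makes one of the groups
  \<open>\<oplus>\<close> and \<open>\<otimes>\<close> cyclic and the other one a Klein four-group, which contradicts that \<open>R\<close> is isomorphic
  to \<open>A\<close> (\<open>star_four_torsion\<close>). So the product is zero, \<open>\<oplus>\<close> is \<open>\<otimes>\<close>, and \<open>R\<close> is the group of
  left translations (\<open>trivial_brace\<close>, \<open>regular_normalized_imp_left_reg\<close>).

  In the remaining cases a second subgroup is obtained by conjugating the left translations with the
  bijection \<open>x \<mapsto> x \<otimes> u [^] q x\<close>, where \<open>u\<close> has prime order \<open>p\<close> and \<open>q\<close> is a quadratic function modulo
  \<open>p\<close> that does not change under multiplication by \<open>u\<close> (\<open>quadratic_twist\<close>). If \<open>p\<close> is odd and \<open>p ^ 2\<close>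
  divides the order, \<open>q x = \<chi> x choose 2\<close> for a character \<open>\<chi>\<close> modulo \<open>p\<close>. If 8 divides the order,
  either the Sylow 2-subgroup is cyclic and the same formula works with a character modulo 4 and
  \<open>p = 2\<close>, or there are two independent characters modulo 2 and \<open>q\<close> is their product. In each case
  the order is large enough for the kernel of the characters to contain a suitable \<open>u\<close>.
\<close>

section \<open>Regular subgroups and left translations\<close>

lemma Perm_simps:
  shows "carrier (Perm G) = Bij (carrier G)"
    and "f \<in> Bij (carrier G) \<Longrightarrow> g \<in> Bij (carrier G) \<Longrightarrow> f \<otimes>\<^bsub>Perm G\<^esub> g = compose (carrier G) f g"
    and "\<one>\<^bsub>Perm G\<^esub> = (\<lambda>x\<in>carrier G. x)"
  by (simp_all add: Perm_def BijGroup_def)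

lemma group_Perm: "group (Perm G)"
  by (simp add: Perm_def group_BijGroup)

lemma Bij_closed: "f \<in> Bij S \<Longrightarrow> x \<in> S \<Longrightarrow> f x \<in> S"
  using Bij_imp_funcset by blast

lemma Bij_ext:
  assumes "f \<in> Bij S" "g \<in> Bij S" "\<And>x. x \<in> S \<Longrightarrow> f x = g x"
  shows "f = g"
  using assms by (meson Bij_imp_extensional extensionalityI)

lemma Perm_mult_apply:
  assumes "f \<in> Bij (carrier G)" "g \<in> Bij (carrier G)" "x \<in> carrier G"
  shows "(f \<otimes>\<^bsub>Perm G\<^esub> g) x = f (g x)"
  using assms by (simp add: Perm_simps compose_def)

lemma (in group) left_reg_Bij:
  assumes "a \<in> carrier G"
  shows "left_reg G a \<in> Bij (carrier G)"
proof -
  have "bij_betw (\<lambda>x. a \<otimes> x) (carrier G) (carrier G)"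
    by (rule bij_betwI[where g = "\<lambda>x. inv a \<otimes> x"])
       (use assms in \<open>auto simp: m_assoc[symmetric]\<close>)
  then show ?thesis
    unfolding left_reg_def Bij_def by (auto cong: bij_betw_cong)
qed

lemma left_reg_apply: "x \<in> carrier G \<Longrightarrow> left_reg G a x = a \<otimes>\<^bsub>G\<^esub> x"
  by (simp add: left_reg_def)

lemma (in group) mem_normalizer_iff:
  assumes "H \<subseteq> carrier G"
  shows "g \<in> normalizer G H \<longleftrightarrow> g \<in> carrier G \<and> (\<lambda>h. g \<otimes> h \<otimes> inv g) ` H = H"
proof -
  have "g <# H #> inv g = (\<lambda>h. g \<otimes> h \<otimes> inv g) ` H"
    by (auto simp: l_coset_def r_coset_def)
  then show ?thesis using assms by (simp add: normalizer_def stabilizer_def)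
qed

text \<open>
  Conjugating \<open>\<eta>\<close> by the translation \<open>left_reg G b\<close> gives \<open>\<eta>'\<close> exactly when
  \<open>b \<otimes> \<eta> z = \<eta>' (b \<otimes> z)\<close> for all \<open>z\<close>. It is enough that every translation conjugates
  \<open>R\<close> into itself: the translation by \<open>inv b\<close> does so too, which turns the inclusion into an equality.
  All later arguments use this pointwise form.
\<close>

lemma (in group) normalized_by_left_reg_iff:
  assumes R: "subgroup R (Perm G)"
  shows "normalized_by_left_reg G R \<longleftrightarrow>
    (\<forall>b\<in>carrier G. \<forall>\<eta>\<in>R. \<exists>\<eta>'\<in>R. \<forall>z\<in>carrier G. b \<otimes> \<eta> z = \<eta>' (b \<otimes> z))" (is "?l \<longleftrightarrow> ?r")
proof -
  interpret P: group "Perm G" by (rule group_Perm)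
  have RB: "R \<subseteq> Bij (carrier G)"
    using subgroup.subset[OF R] by (simp add: Perm_simps)
  note lB = left_reg_Bij[unfolded Perm_simps(1)[symmetric]]
  have comm: "left_reg G b \<otimes>\<^bsub>Perm G\<^esub> \<eta> \<otimes>\<^bsub>Perm G\<^esub> inv\<^bsub>Perm G\<^esub> left_reg G b = \<eta>'
      \<longleftrightarrow> (\<forall>z\<in>carrier G. b \<otimes> \<eta> z = \<eta>' (b \<otimes> z))"
    if b: "b \<in> carrier G" and e: "\<eta> \<in> R" "\<eta>' \<in> R" for b \<eta> \<eta>'
  proof -
    have eB: "\<eta> \<in> Bij (carrier G)" "\<eta>' \<in> Bij (carrier G)" using e RB by auto
    note eP = eB[unfolded Perm_simps(1)[symmetric]]
    have "left_reg G b \<otimes>\<^bsub>Perm G\<^esub> \<eta> \<otimes>\<^bsub>Perm G\<^esub> inv\<^bsub>Perm G\<^esub> left_reg G b = \<eta>'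
      \<longleftrightarrow> left_reg G b \<otimes>\<^bsub>Perm G\<^esub> \<eta> = \<eta>' \<otimes>\<^bsub>Perm G\<^esub> left_reg G b"
      using lB[OF b] eP
      by (metis P.inv_closed P.inv_solve_right P.m_closed)
    also have "\<dots> \<longleftrightarrow> (\<forall>z\<in>carrier G. (left_reg G b \<otimes>\<^bsub>Perm G\<^esub> \<eta>) z = (\<eta>' \<otimes>\<^bsub>Perm G\<^esub> left_reg G b) z)"
      using Bij_ext[of "left_reg G b \<otimes>\<^bsub>Perm G\<^esub> \<eta>" "carrier G" "\<eta>' \<otimes>\<^bsub>Perm G\<^esub> left_reg G b"] P.m_closed lB[OF b] eP
      by (auto simp: Perm_simps(1))
    also have "\<dots> \<longleftrightarrow> (\<forall>z\<in>carrier G. b \<otimes> \<eta> z = \<eta>' (b \<otimes> z))"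
      using b eB by (simp add: Perm_mult_apply left_reg_Bij left_reg_apply Bij_closed)
    finally show ?thesis .
  qed
  let ?c = "\<lambda>b \<eta>. left_reg G b \<otimes>\<^bsub>Perm G\<^esub> \<eta> \<otimes>\<^bsub>Perm G\<^esub> inv\<^bsub>Perm G\<^esub> left_reg G b"
  have "left_reg G b \<in> normalizer (Perm G) R \<longleftrightarrow> ?c b ` R = R" if "b \<in> carrier G" for b
    using lB[OF that] by (simp only: P.mem_normalizer_iff[OF subgroup.subset[OF R]] simp_thms)
  then have "?l \<longleftrightarrow> (\<forall>b\<in>carrier G. ?c b ` R = R)"
    unfolding normalized_by_left_reg_def image_subset_iff by (rule ball_cong[OF refl])
  also have "\<dots> \<longleftrightarrow> (\<forall>b\<in>carrier G. ?c b ` R \<subseteq> R)"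
  proof (intro iffI ballI)
    fix b assume A: "\<forall>b\<in>carrier G. ?c b ` R \<subseteq> R" and b: "b \<in> carrier G"
    have inv: "left_reg G (inv b) = inv\<^bsub>Perm G\<^esub> left_reg G b"
    proof (rule P.inv_equality[symmetric])
      show "left_reg G (inv b) \<otimes>\<^bsub>Perm G\<^esub> left_reg G b = \<one>\<^bsub>Perm G\<^esub>"
        using b by (auto intro!: Bij_ext[of _ "carrier G"] P.m_closed[unfolded Perm_simps(1)]
          simp: Perm_mult_apply left_reg_Bij left_reg_apply Perm_simps(3) id_Bij m_assoc[symmetric])
    qed (use lB b in auto)
    have "\<eta> \<in> ?c b ` R" if e: "\<eta> \<in> R" for \<eta>
    proof -
      have 1: "?c (inv b) \<eta> \<in> R"
        using bspec[OF A inv_closed[OF b]] e unfolding image_subset_iff by (rule bspec)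
      have "\<eta> \<in> carrier (Perm G)" using e subgroup.subset[OF R] by auto
      then have "?c b (?c (inv b) \<eta>) = \<eta>"
        using lB[OF b] unfolding inv by (simp add: P.m_assoc) (metis P.inv_closed P.l_one P.m_assoc P.r_inv)
      then show ?thesis by (rule rev_image_eqI[OF 1 sym])
    qed
    then show "?c b ` R = R" using A b by (intro equalityI) (auto simp only: subset_iff)
  next
    fix b assume "\<forall>b\<in>carrier G. ?c b ` R = R" "b \<in> carrier G"
    then have "?c b ` R = R" by (rule bspec)
    then show "?c b ` R \<subseteq> R" by (rule equalityD1)
  qed
  also have "\<dots> \<longleftrightarrow> ?r"
    unfolding image_subset_iff
  proof (intro ball_cong[OF refl])
    fix b \<eta> assume "b \<in> carrier G" "\<eta> \<in> R"
    note c = comm[OF this]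
    show "?c b \<eta> \<in> R \<longleftrightarrow> (\<exists>\<eta>'\<in>R. \<forall>z\<in>carrier G. b \<otimes> \<eta> z = \<eta>' (b \<otimes> z))"
    proof
      assume "?c b \<eta> \<in> R"
      with c[OF this] show "\<exists>\<eta>'\<in>R. \<forall>z\<in>carrier G. b \<otimes> \<eta> z = \<eta>' (b \<otimes> z)" by blast
    next
      assume "\<exists>\<eta>'\<in>R. \<forall>z\<in>carrier G. b \<otimes> \<eta> z = \<eta>' (b \<otimes> z)"
      then obtain \<eta>' where "\<eta>' \<in> R" "?c b \<eta> = \<eta>'" using c by blast
      then show "?c b \<eta> \<in> R" by simp
    qed
  qed
  finally show ?thesis .
qed

text \<open>
  The translation by \<open>a\<close> in the group structure that \<open>\<phi>\<close> transports to the same set, written with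
  an inverse \<open>\<psi>\<close> of \<open>\<phi>\<close>: it is the conjugate of \<open>left_reg G a\<close> by \<open>\<phi>\<close>.
\<close>

definition transported_reg :: "('a, 'm) monoid_scheme \<Rightarrow> ('a \<Rightarrow> 'a) \<Rightarrow> ('a \<Rightarrow> 'a) \<Rightarrow> 'a \<Rightarrow> ('a \<Rightarrow> 'a)" where
  "transported_reg G \<phi> \<psi> a = (\<lambda>x\<in>carrier G. \<phi> (a \<otimes>\<^bsub>G\<^esub> \<psi> x))"

text \<open>
  A conjugate of the left regular representation is again regular and isomorphic to the group; whether
  the translations normalize it depends on the bijection.
\<close>

lemma (in group) transported_reg:
  fixes \<phi> \<psi> defines "R \<equiv> transported_reg G \<phi> \<psi> ` carrier G"
  assumes \<phi>: "\<And>x. x \<in> carrier G \<Longrightarrow> \<phi> x \<in> carrier G" and \<psi>: "\<And>x. x \<in> carrier G \<Longrightarrow> \<psi> x \<in> carrier G"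
    and \<psi>\<phi>: "\<And>x. x \<in> carrier G \<Longrightarrow> \<psi> (\<phi> x) = x" and \<phi>\<psi>: "\<And>x. x \<in> carrier G \<Longrightarrow> \<phi> (\<psi> x) = x"
  shows transported_reg_regular: "regular_subgroup G R"
    and transported_reg_iso: "(Perm G)\<lparr>carrier := R\<rparr> \<cong> G"
proof -
  interpret P: group "Perm G" by (rule group_Perm)
  let ?t = "transported_reg G \<phi> \<psi>"
  have app: "?t a x = \<phi> (a \<otimes> \<psi> x)" if "x \<in> carrier G" for a x
    using that by (simp add: transported_reg_def)
  have bij: "?t a \<in> Bij (carrier G)" if a: "a \<in> carrier G" for a
  proof -
    have "bij_betw (?t a) (carrier G) (carrier G)"
      by (rule bij_betwI[where g = "?t (inv a)"])
         (use a in \<open>auto simp: app \<phi> \<psi> \<psi>\<phi> \<phi>\<psi> m_assoc[symmetric]\<close>)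
    then show ?thesis by (auto simp: Bij_def transported_reg_def)
  qed
  have ev: "?t a \<one> = \<phi> (a \<otimes> \<psi> \<one>)" for a by (simp add: app)
  have bij1: "bij_betw (\<lambda>a. ?t a \<one>) (carrier G) (carrier G)"
    by (rule bij_betwI[where g = "\<lambda>x. \<psi> x \<otimes> inv (\<psi> \<one>)"])
       (simp_all add: ev \<phi> \<psi> \<psi>\<phi> \<phi>\<psi> m_assoc)
  have hom: "?t \<in> hom G (Perm G)"
  proof (rule homI)
    show "?t x \<in> carrier (Perm G)" if "x \<in> carrier G" for x
      using bij that by (simp add: Perm_simps)
    show "?t (x \<otimes> y) = ?t x \<otimes>\<^bsub>Perm G\<^esub> ?t y" if "x \<in> carrier G" "y \<in> carrier G" for x y
    proof (rule Bij_ext[of _ "carrier G"])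
      show "?t x \<otimes>\<^bsub>Perm G\<^esub> ?t y \<in> Bij (carrier G)"
        using P.m_closed bij that by (simp add: Perm_simps(1))
    qed (use that bij in \<open>auto simp: Perm_mult_apply app \<phi> \<psi> \<psi>\<phi> m_assoc\<close>)
  qed
  then interpret t: group_hom G "Perm G" ?t by unfold_locales
  have sub: "subgroup R (Perm G)" unfolding R_def by (rule t.img_is_subgroup)
  have inj: "inj_on ?t (carrier G)"
    using bij_betw_imp_inj_on[OF bij1] by (auto simp: inj_on_def)
  have "bij_betw (\<lambda>\<eta>. \<eta> \<one>) R (carrier G)"
    using bij1 unfolding R_def bij_betw_def inj_on_def by (auto simp: image_image)
  with sub show "regular_subgroup G R" by (simp add: regular_subgroup_def)
  have "?t \<in> iso G ((Perm G)\<lparr>carrier := R\<rparr>)"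
    using hom inj by (auto simp: iso_def hom_def bij_betw_def R_def)
  then show "(Perm G)\<lparr>carrier := R\<rparr> \<cong> G"
    using iso_sym is_isoI by blast
qed

section \<open>Torsion in finite groups\<close>

lemma (in group) Cauchy:
  assumes fin: "finite (carrier G)" and p: "Factorial_Ring.prime p" "p dvd order G"
  obtains x where "x \<in> carrier G" "x \<noteq> \<one>" "x [^] p = \<one>"
proof -
  obtain m where "order G = p ^ 1 * m" using p(2) by auto
  then obtain H where H: "subgroup H G" "card H = p ^ 1"
    using sylow_thm[OF p(1) is_group _ fin] by blast
  interpret H: group "G\<lparr>carrier := H\<rparr>" using H(1) by (rule subgroup_imp_group)
  have "card H > 1" using H(2) p(1) by (simp add: prime_gt_Suc_0_nat)
  then have "\<not> H \<subseteq> {\<one>}" using card_mono[of "{\<one>}" H] by auto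
  then obtain x where x: "x \<in> H" "x \<noteq> \<one>" by blast
  have "finite H" using H(1) fin finite_subset subgroup.subset by blast
  then have "x [^]\<^bsub>G\<lparr>carrier := H\<rparr>\<^esub> p = \<one>"
    using H.pow_order_eq_1[of x] x(1) H(2) by (simp add: order_def)
  then have "x [^] p = \<one>" by (simp flip: nat_pow_consistent)
  with x show ?thesis using that subgroup.mem_carrier[OF H(1)] by blast
qed

lemma (in group) card_subgroup_dvd:
  assumes "subgroup V G" "subgroup U G" "V \<subseteq> U"
  shows "card V dvd card U"
proof -
  interpret U: group "G\<lparr>carrier := U\<rparr>" using assms(2) by (rule subgroup_imp_group)
  have "subgroup V (G\<lparr>carrier := U\<rparr>)" using assms by (rule subgroup_incl)
  from U.lagrange[OF this] show ?thesis by (simp add: order_def flip: dvd_triv_right) (metis dvd_triv_right)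
qed

lemma (in comm_group) subgroup_torsion:
  "subgroup {x \<in> carrier G. x [^] (n::nat) = \<one>} G"
  by (rule subgroupI) (auto simp: nat_pow_distrib nat_pow_inv nat_pow_one intro: exI[of _ "\<one>"])

text \<open>
  By Cauchy's theorem no prime other than \<open>p\<close> divides the order of this subgroup, so that order is
  coprime to \<open>m\<close>, and it divides \<open>p ^ a * m\<close> by Lagrange's theorem.
\<close>

lemma (in comm_group) card_primary_torsion_dvd:
  fixes p :: nat
  assumes fin: "finite (carrier G)" and p: "Factorial_Ring.prime p"
    and ord: "order G = p ^ a * m" and m: "\<not> p dvd m"
  shows "card {x \<in> carrier G. x [^] (p ^ a) = \<one>} dvd p ^ a" (is "card ?T dvd _")
proof -
  have T: "subgroup ?T G" by (rule subgroup_torsion)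
  interpret T: group "G\<lparr>carrier := ?T\<rparr>" using T by (rule subgroup_imp_group)
  have finT: "finite ?T" using fin by simp
  have "q = p" if q: "Factorial_Ring.prime q" "q dvd card ?T" for q
  proof (rule ccontr)
    assume "q \<noteq> p"
    then have cop: "coprime q (p ^ a)" using q(1) p by (simp add: primes_coprime)
    obtain x where x: "x \<in> ?T" "x \<noteq> \<one>" "x [^]\<^bsub>G\<lparr>carrier := ?T\<rparr>\<^esub> q = \<one>"
      using T.Cauchy[of q] q finT by (auto simp: order_def)
    then have "ord x dvd q" "ord x dvd p ^ a"
      by (auto simp flip: nat_pow_consistent pow_eq_id)
    then have "ord x = 1" using cop by (metis coprime_common_divisor nat_dvd_1_iff_1)
    then show False using x ord_eq_1 by auto
  qed
  note only_p = this
  have "coprime (card ?T) m"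
  proof (rule ccontr)
    assume "\<not> coprime (card ?T) m"
    then have "gcd (card ?T) m \<noteq> 1" by (simp only: coprime_iff_gcd_eq_1 not_False_eq_True)
    then obtain q where "Factorial_Ring.prime q" "q dvd gcd (card ?T) m" using prime_factor_nat by blast
    then show False using only_p[of q] m by (simp only: gcd_greatest_iff) simp
  qed
  moreover have "card ?T dvd p ^ a * m"
    using card_subgroup_dvd[OF T subgroup_self] ord by (auto simp: order_def)
  ultimately show ?thesis by (simp add: coprime_dvd_mult_left_iff)
qed

section \<open>Commutative braces as nilpotent rings\<close>

text \<open>
  Two abelian group structures on one set, \<open>\<oplus>\<close> and \<open>\<otimes>\<close>, such that for each \<open>a\<close> the map
  sending \<open>x\<close> to \<open>a \<otimes> x\<close> minus \<open>a\<close> is additive. The record type of rings is used only as a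
  container for two operations: \<open>\<otimes>\<close> is a group operation, not a ring product.
\<close>

locale comm_brace = comm_group B + abelian_group B for B :: "('a, 'm) ring_scheme" (structure) +
  assumes brace: "\<lbrakk>a \<in> carrier B; x \<in> carrier B; y \<in> carrier B\<rbrakk>
    \<Longrightarrow> a \<otimes> (x \<oplus> y) \<oplus> a = (a \<otimes> x) \<oplus> (a \<otimes> y)"
begin

text \<open>
  The product for which \<open>\<oplus>\<close> and \<open>\<star>\<close> form a commutative ring without unit that has
  \<open>\<otimes>\<close> as its adjoint (circle) operation.
\<close>

definition star :: "'a \<Rightarrow> 'a \<Rightarrow> 'a" (infixl \<open>\<star>\<close> 70)
  where "a \<star> x = (a \<otimes> x) \<oplus> \<ominus> (a \<oplus> x)"

lemma star_closed [simp, intro]: "\<lbrakk>a \<in> carrier B; x \<in> carrier B\<rbrakk> \<Longrightarrow> a \<star> x \<in> carrier B"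
  by (simp add: star_def)

lemma mult_eq: "\<lbrakk>a \<in> carrier B; x \<in> carrier B\<rbrakk> \<Longrightarrow> a \<otimes> x = a \<oplus> x \<oplus> a \<star> x"
  by (simp add: star_def a_comm[of "a \<otimes> x"] r_neg1 r_neg2 a_assoc[symmetric] r_neg)

lemma star_eqI:
  assumes "a \<in> carrier B" "x \<in> carrier B" "z \<in> carrier B" "a \<otimes> x = a \<oplus> x \<oplus> z"
  shows "a \<star> x = z"
  using assms by (metis add.l_cancel add.m_closed mult_eq star_closed)

lemma star_comm: "\<lbrakk>a \<in> carrier B; x \<in> carrier B\<rbrakk> \<Longrightarrow> a \<star> x = x \<star> a"
  by (simp add: star_def m_comm a_comm)

lemma star_add_right:
  assumes "a \<in> carrier B" "x \<in> carrier B" "y \<in> carrier B"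
  shows "a \<star> (x \<oplus> y) = a \<star> x \<oplus> a \<star> y"
proof (rule star_eqI)
  have "a \<otimes> (x \<oplus> y) \<oplus> a = (a \<oplus> x \<oplus> a \<star> x) \<oplus> (a \<oplus> y \<oplus> a \<star> y)"
    using assms by (simp add: brace flip: mult_eq)
  also have "\<dots> = (a \<oplus> (x \<oplus> y) \<oplus> (a \<star> x \<oplus> a \<star> y)) \<oplus> a"
    using assms by (simp add: a_ac)
  finally show "a \<otimes> (x \<oplus> y) = a \<oplus> (x \<oplus> y) \<oplus> (a \<star> x \<oplus> a \<star> y)"
    using assms by (metis add.r_cancel add.m_closed m_closed star_closed)
qed (use assms in auto)

lemma star_add_left:
  assumes "a \<in> carrier B" "x \<in> carrier B" "y \<in> carrier B"
  shows "(x \<oplus> y) \<star> a = x \<star> a \<oplus> y \<star> a"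
  using assms by (simp add: star_comm[of _ a] star_add_right)

lemma star_zero [simp]:
  assumes "a \<in> carrier B" shows "a \<star> \<zero> = \<zero>" "\<zero> \<star> a = \<zero>"
proof -
  have "a \<star> \<zero> \<oplus> a \<star> \<zero> = a \<star> \<zero>" using star_add_right[of a \<zero> \<zero>] assms by simp
  then show "a \<star> \<zero> = \<zero>" using assms by (metis add.l_cancel_one zero_closed star_closed)
  then show "\<zero> \<star> a = \<zero>" using assms by (simp add: star_comm)
qed

lemma one_eq_zero: "\<one> = \<zero>"
  using mult_eq[of \<one> \<zero>] by simp

lemma star_minus:
  assumes "a \<in> carrier B" "x \<in> carrier B" shows "(\<ominus> a) \<star> x = \<ominus> (a \<star> x)"
  using star_add_left[of x a "\<ominus> a"] assms by (simp add: r_neg add.inv_equality[symmetric] a_comm[of "\<ominus> a \<star> x"]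
     minus_equality)

text \<open>
  When both sides of the associative law for \<open>\<otimes>\<close> are expanded by \<open>mult_eq\<close>, all terms cancel except
  the two triple products.
\<close>

lemma star_assoc:
  assumes "a \<in> carrier B" "x \<in> carrier B" "y \<in> carrier B"
  shows "(a \<star> x) \<star> y = a \<star> (x \<star> y)"
proof -
  let ?s = "a \<oplus> x \<oplus> y \<oplus> a \<star> x \<oplus> a \<star> y \<oplus> x \<star> y"
  have "(a \<otimes> x) \<otimes> y = ?s \<oplus> (a \<star> x) \<star> y"
    using assms by (simp add: mult_eq star_add_left a_ac)
  moreover have "a \<otimes> (x \<otimes> y) = ?s \<oplus> a \<star> (x \<star> y)"
    using assms by (simp add: mult_eq star_add_right a_ac)
  ultimately show ?thesis using assms m_assoc[of a x y] by simp
qed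

lemma star_add_pow:
  assumes "a \<in> carrier B" "x \<in> carrier B" shows "a \<star> add_pow B (n::nat) x = add_pow B n (a \<star> x)"
  by (induction n) (use assms in \<open>simp_all add: star_add_right\<close>)

text \<open>
  The equation \<open>a \<star> x = x\<close> says that the translation by \<open>\<ominus> a\<close> in the group \<open>\<otimes>\<close> sends
  \<open>x\<close> to \<open>\<ominus> a\<close>, which is also the image of the neutral element. This is how
  inverses for \<open>\<otimes>\<close> make the ring nilpotent.
\<close>

lemma star_fixed_imp_zero:
  assumes "a \<in> carrier B" "x \<in> carrier B" "a \<star> x = x" shows "x = \<zero>"
proof -
  have "(\<ominus> a) \<otimes> x = (\<ominus> a) \<otimes> \<one>"
    using assms by (simp add: mult_eq star_minus one_eq_zero a_assoc r_neg)
  then show ?thesis using assms by (simp add: one_eq_zero)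
qed

definition brace_ideal :: "'a set \<Rightarrow> bool"
  where "brace_ideal U \<longleftrightarrow> subgroup U (add_monoid B) \<and> (\<forall>a\<in>carrier B. \<forall>x\<in>U. a \<star> x \<in> U)"

lemma brace_ideal_mem: "brace_ideal U \<Longrightarrow> x \<in> U \<Longrightarrow> x \<in> carrier B"
  using subgroup.mem_carrier by (fastforce simp: brace_ideal_def)

text \<open>
  In the sequence \<open>x\<close>, \<open>a \<star> x\<close>, \<open>a \<star> (a \<star> x)\<close>, ... two terms coincide. The earlier of them is
  then fixed by multiplication with a power of \<open>a\<close>, so it is zero.
\<close>

lemma star_nilpotent:
  assumes fin: "finite (carrier B)" and a: "a \<in> carrier B" and x: "x \<in> carrier B"
  shows "\<exists>n. ((\<star>) a ^^ n) x = \<zero>"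
proof -
  have cl: "((\<star>) a ^^ n) z \<in> carrier B" if "z \<in> carrier B" for n z
    by (induction n) (use a that in auto)
  have pow: "\<exists>b\<in>carrier B. \<forall>z\<in>carrier B. ((\<star>) a ^^ Suc n) z = b \<star> z" for n
  proof (induction n)
    case 0
    then show ?case using a by auto
  next
    case (Suc n)
    then obtain b where "b \<in> carrier B" "\<forall>z\<in>carrier B. ((\<star>) a ^^ Suc n) z = b \<star> z" by blast
    then show ?case using a by (intro bexI[of _ "a \<star> b"]) (auto simp: star_assoc)
  qed
  have "\<not> inj (\<lambda>n. ((\<star>) a ^^ n) x)"
    using cl[OF x] fin by (meson finite_imageD finite_subset image_subsetI infinite_UNIV_nat)
  then obtain i j where ij: "i < j" "((\<star>) a ^^ i) x = ((\<star>) a ^^ j) x"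
    unfolding inj_def using linorder_neqE_nat by metis
  then obtain k where k: "j = Suc k + i" by (metis add.commute less_imp_Suc_add add_Suc_right)
  obtain b where b: "b \<in> carrier B" "\<forall>z\<in>carrier B. ((\<star>) a ^^ Suc k) z = b \<star> z" using pow by blast
  have "((\<star>) a ^^ j) x = b \<star> ((\<star>) a ^^ i) x"
    using b(2) cl[OF x, of i] unfolding k funpow_add by simp
  then have "((\<star>) a ^^ i) x = \<zero>" using ij(2) b(1) cl[OF x] star_fixed_imp_zero by metis
  then show ?thesis by blast
qed

text \<open>
  If multiplication by \<open>a\<close> mapped a finite ideal onto itself, it would be injective on it, and no
  nonzero element could be killed by a power of \<open>a\<close>.
\<close>

lemma star_image_proper:
  assumes fin: "finite (carrier B)" and U: "brace_ideal U" and a: "a \<in> carrier B"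
    and x: "x \<in> U" "x \<noteq> \<zero>"
  shows "(\<star>) a ` U \<noteq> U"
proof
  assume eq: "(\<star>) a ` U = U"
  have "U \<subseteq> carrier B" using brace_ideal_mem[OF U] by blast
  then have "finite U" using fin finite_subset by blast
  then have inj: "inj_on ((\<star>) a) U" using eq by (simp add: eq_card_imp_inj_on)
  have mem: "((\<star>) a ^^ n) x \<in> U" for n by (induction n) (use x eq in auto)
  have zero: "\<zero> \<in> U" using U subgroup.one_closed by (fastforce simp: brace_ideal_def)
  have "((\<star>) a ^^ n) x \<noteq> \<zero>" for n
  proof (induction n)
    case (Suc n)
    then show ?case using inj_onD[OF inj _ mem zero, of n] a by auto
  qed (use x in auto)
  then show False using star_nilpotent[OF fin a] brace_ideal_mem[OF U x(1)] by blast
qed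

lemma brace_ideal_star_image:
  assumes U: "brace_ideal U" and a: "a \<in> carrier B"
  shows "brace_ideal ((\<star>) a ` U)"
proof -
  have U': "subgroup U (add_monoid B)" and c: "b \<in> carrier B \<Longrightarrow> x \<in> U \<Longrightarrow> b \<star> x \<in> U" for b x
    using U by (auto simp: brace_ideal_def)
  note mem = brace_ideal_mem[OF U]
  have "subgroup ((\<star>) a ` U) (add_monoid B)"
  proof (rule add.subgroupI)
    show "(\<star>) a ` U \<subseteq> carrier B" using a mem by auto
    show "(\<star>) a ` U \<noteq> {}" using subgroup.one_closed[OF U'] by auto
  next
    fix y assume "y \<in> (\<star>) a ` U"
    then obtain x where x: "x \<in> U" "y = a \<star> x" by blast
    have "\<ominus> x \<in> U" using subgroup.m_inv_closed[OF U' x(1)] by (simp add: a_inv_def)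
    moreover have "\<ominus> y = a \<star> (\<ominus> x)" using a mem[OF x(1)] x(2) by (simp add: star_comm[of a] star_minus)
    ultimately show "\<ominus> y \<in> (\<star>) a ` U" by blast
  next
    fix y z assume "y \<in> (\<star>) a ` U" "z \<in> (\<star>) a ` U"
    then obtain u v where u: "u \<in> U" "y = a \<star> u" and v: "v \<in> U" "z = a \<star> v" by blast
    have "u \<oplus> v \<in> U" using subgroup.m_closed[OF U' u(1) v(1)] by simp
    moreover have "y \<oplus> z = a \<star> (u \<oplus> v)" using a mem u v by (simp add: star_add_right)
    ultimately show "y \<oplus> z \<in> (\<star>) a ` U" by blast
  qed
  moreover have "b \<star> (a \<star> x) \<in> (\<star>) a ` U" if "b \<in> carrier B" "x \<in> U" for b x
  proof -
    have "b \<star> (a \<star> x) = a \<star> (b \<star> x)"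
      using that a mem by (simp add: star_comm[of b] star_assoc flip: star_assoc[of b])
    then show ?thesis using c[OF that] by blast
  qed
  ultimately show ?thesis by (auto simp: brace_ideal_def)
qed

lemma star_image_smaller:
  assumes fin: "finite (carrier B)" and U: "brace_ideal U" and a: "a \<in> carrier B"
  shows "card ((\<star>) a ` U) dvd card U" and "card ((\<star>) a ` U) = card U \<Longrightarrow> card U = 1"
proof -
  have sub: "(\<star>) a ` U \<subseteq> U" using U a by (auto simp: brace_ideal_def)
  show "card ((\<star>) a ` U) dvd card U"
    using add.card_subgroup_dvd[OF _ _ sub] U brace_ideal_star_image[OF U a] by (simp add: brace_ideal_def)
  assume "card ((\<star>) a ` U) = card U"
  moreover have finU: "finite U" using fin brace_ideal_mem[OF U] by (metis finite_subset subsetI)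
  ultimately have "(\<star>) a ` U = U" using sub by (simp add: card_subset_eq)
  then have "U \<subseteq> {\<zero>}" using star_image_proper[OF fin U a] by blast
  moreover have "\<zero> \<in> U" using U subgroup.one_closed by (fastforce simp: brace_ideal_def)
  ultimately have "U = {\<zero>}" by blast
  then show "card U = 1" by simp
qed

text \<open>
  Unless \<open>U\<close> is zero, the ideal \<open>a \<star> U\<close> has a smaller order, which divides that of \<open>U\<close>; so it is zero.
\<close>

lemma star_prime_ideal:
  assumes fin: "finite (carrier B)" and U: "brace_ideal U" and p: "Factorial_Ring.prime p" "card U dvd p"
    and a: "a \<in> carrier B" and x: "x \<in> U"
  shows "a \<star> x = \<zero>"
proof -
  have V: "brace_ideal ((\<star>) a ` U)" by (rule brace_ideal_star_image[OF U a])
  have "card ((\<star>) a ` U) = 1"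
  proof (rule ccontr)
    assume ne: "card ((\<star>) a ` U) \<noteq> 1"
    note d = star_image_smaller[OF fin U a]
    have "card ((\<star>) a ` U) = p" using dvd_trans[OF d(1) p(2)] p(1) ne by (auto simp: prime_nat_iff)
    moreover from this have "card U = p" using d(1) p(2) by (simp add: dvd_antisym)
    ultimately show False using d(2) ne by simp
  qed
  moreover have "\<zero> \<in> (\<star>) a ` U" using V subgroup.one_closed by (fastforce simp: brace_ideal_def)
  ultimately have "(\<star>) a ` U = {\<zero>}" by (metis card_1_singletonE singletonD)
  then show ?thesis using x by blast
qed

end

section \<open>Braces with small Sylow subgroups\<close>

context comm_brace begin

lemma brace_ideal_torsion: "brace_ideal {x \<in> carrier B. add_pow B (n::nat) x = \<zero>}"
  using add.subgroup_torsion[of n] by (auto simp: brace_ideal_def star_add_pow[symmetric])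

lemma add_pow_card:
  assumes "subgroup U (add_monoid B)" "finite U" "x \<in> U"
  shows "add_pow B (card U) x = \<zero>"
proof -
  interpret U: group "(add_monoid B)\<lparr>carrier := U\<rparr>" using add.subgroup_imp_group[OF assms(1)] .
  show ?thesis
    using U.pow_order_eq_1[of x] assms add.nat_pow_consistent[of "card U" x U]
    by (simp add: order_def)
qed

lemma double_involution:
  assumes "x \<in> carrier B" "y \<in> carrier B" "x \<oplus> x = \<zero>"
  shows "x \<oplus> (x \<oplus> y) = y"
  using assms by (simp flip: a_assoc)

text \<open>
  Let \<open>T\<close> have order 4. Multiplying \<open>T\<close> by an element leaves an ideal of order at most 2, and
  multiplying once more gives 0; this yields \<open>cube\<close> and \<open>dbl\<close>. What remains are the two
  nonzero nilpotent products, and in both of them the two group structures on \<open>T\<close> are not isomorphic.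
  If \<open>T\<close> is additively cyclic, generated by \<open>g\<close> with \<open>g \<star> g = g \<oplus> g\<close>, then \<open>t \<otimes> t = \<zero>\<close>
  for all four \<open>t\<close> in \<open>T\<close>, while \<open>w \<oplus> w = \<zero>\<close> has two solutions only. If \<open>T\<close> is a Klein
  four-group and \<open>w \<star> w\<close> is not zero, then \<open>w\<close> has order 4 for \<open>\<otimes>\<close>, while no element has
  order 4 for \<open>\<oplus>\<close>; and if all squares vanish, a nonzero product \<open>x \<star> y\<close> would be a
  fifth element of \<open>T\<close>. The isomorphism is given on the whole brace, so orders of elements are
  compared there: \<open>T\<close> contains every element of additive order dividing 4.
\<close>

lemma star_four_torsion:
  assumes fin: "finite (carrier B)"
    and T_def: "T = {x \<in> carrier B. add_pow B (4::nat) x = \<zero>}" and card_T: "card T dvd 4"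
    and f: "bij_betw f (carrier B) (carrier B)"
      "\<And>x y. x \<in> carrier B \<Longrightarrow> y \<in> carrier B \<Longrightarrow> f (x \<otimes> y) = f x \<oplus> f y"
    and xy: "x \<in> T" "y \<in> T"
  shows "x \<star> y = \<zero>"
proof -
  have T: "brace_ideal T" unfolding T_def by (rule brace_ideal_torsion)
  then have T': "subgroup T (add_monoid B)" and Ts: "a \<in> carrier B \<Longrightarrow> x \<in> T \<Longrightarrow> a \<star> x \<in> T" for a x
    by (auto simp: brace_ideal_def)
  have Tc: "x \<in> carrier B" if "x \<in> T" for x using that by (simp add: T_def)
  have finT: "finite T" using fin by (simp add: T_def)
  have Ta: "x \<oplus> y \<in> T" if "x \<in> T" "y \<in> T" for x y using subgroup.m_closed[OF T' that] by simp
  have T0: "\<zero> \<in> T" using subgroup.one_closed[OF T'] by simp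
  have pow4: "add_pow B (4::nat) x = (x \<oplus> x) \<oplus> (x \<oplus> x)" if "x \<in> carrier B" for x
    using that by (simp add: numeral_eq_Suc a_ac)
  have f0: "f \<zero> = \<zero>"
  proof -
    have "f \<zero> \<oplus> f \<zero> = f \<zero>" using f(2)[of \<zero> \<zero>] by (simp flip: one_eq_zero)
    moreover have "f \<zero> \<in> carrier B" using f(1) by (simp add: bij_betwE)
    ultimately show ?thesis by simp
  qed
  have fz: "x = \<zero>" if "x \<in> carrier B" "f x = \<zero>" for x
    using f(1) f0 that by (metis bij_betw_inv_into_left zero_closed)
  have fc: "f x \<in> carrier B" if "x \<in> carrier B" for x using f(1) that by (auto simp: bij_betw_def)
  consider "card T dvd 2" | "card T = 4"
  proof -
    have "card T \<le> 4" using card_T by (simp add: dvd_imp_le)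
    then have "card T \<in> {0,1,2,3,4}" by auto
    then show ?thesis using card_T that by auto
  qed
  then show ?thesis
  proof cases
    case 1
    then show ?thesis using star_prime_ideal[OF fin T two_is_prime_nat] xy Tc by blast
  next
    case 2
    have small: "card ((\<star>) a ` T) dvd 2" if "a \<in> carrier B" for a
    proof -
      note d = star_image_smaller[OF fin T that]
      have "card ((\<star>) a ` T) \<noteq> 4" using d(2) 2 by auto
      moreover have "card ((\<star>) a ` T) \<in> {0,1,2,3,4}" using d(1) 2 dvd_imp_le[OF d(1)] by auto
      ultimately show ?thesis using d(1) 2 by auto
    qed
    have cube: "b \<star> (a \<star> z) = \<zero>" if "a \<in> carrier B" "b \<in> carrier B" "z \<in> T" for a b z
      using star_prime_ideal[OF fin brace_ideal_star_image[OF T] two_is_prime_nat small] that by blast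
    have dbl: "a \<star> z \<oplus> a \<star> z = \<zero>" if "a \<in> carrier B" "z \<in> T" for a z
    proof -
      have "subgroup ((\<star>) a ` T) (add_monoid B)"
        using brace_ideal_star_image[OF T that(1)] by (simp add: brace_ideal_def)
      from add_pow_card[OF this] have "add_pow B (card ((\<star>) a ` T)) (a \<star> z) = \<zero>"
        using finT that by blast
      then have "add_pow B (2::nat) (a \<star> z) = \<zero>"
        using small[OF that(1)] that Tc add.pow_eq_id by (meson dvd_trans star_closed)
      then show ?thesis using that Tc by (simp add: numeral_eq_Suc)
    qed
    show ?thesis
    proof (cases "\<exists>g\<in>T. g \<oplus> g \<noteq> \<zero>")
      case True
      then obtain g where g: "g \<in> T" "g \<oplus> g \<noteq> \<zero>" by blast
      let ?g2 = "g \<oplus> g" let ?g3 = "?g2 \<oplus> g"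
      have gc [simp]: "g \<in> carrier B" using g Tc by simp
      have g4: "?g2 \<oplus> ?g2 = \<zero>" using g(1) pow4 by (simp add: T_def)
      have g4': "g \<oplus> (g \<oplus> (g \<oplus> g)) = \<zero>" using g4 by (simp add: a_assoc)
      have g0: "g \<noteq> \<zero>" using g by auto
      have g30: "?g3 \<noteq> \<zero>"
      proof
        assume "?g3 = \<zero>"
        then have "?g3 \<oplus> g = \<zero> \<oplus> g" by simp
        then show False using g4 g0 by (simp add: a_assoc)
      qed
      have "card {\<zero>, g, ?g2, ?g3} = 4"
        using g0 g30 g(2) by (auto simp: a_assoc)
      moreover have "{\<zero>, g, ?g2, ?g3} \<subseteq> T" using g(1) T0 Ta by auto
      ultimately have Teq: "T = {\<zero>, g, ?g2, ?g3}" using 2 finT by (metis card_subset_eq)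
      have g33: "?g3 \<oplus> ?g3 = ?g2" using g4' by (simp add: a_assoc)
      have inv2: "{w \<in> carrier B. w \<oplus> w = \<zero>} \<subseteq> {\<zero>, ?g2}"
      proof
        fix w assume "w \<in> {w \<in> carrier B. w \<oplus> w = \<zero>}"
        then have w: "w \<in> carrier B" "w \<oplus> w = \<zero>" by auto
        then have "w \<in> T" by (simp add: T_def pow4)
        then show "w \<in> {\<zero>, ?g2}" using w(2) g(2) g33 unfolding Teq by auto
      qed
      have gg: "g \<star> g = \<zero>"
      proof (rule ccontr)
        assume ne: "g \<star> g \<noteq> \<zero>"
        have "g \<star> g \<in> {w \<in> carrier B. w \<oplus> w = \<zero>}" using dbl g(1) by simp
        then have gg: "g \<star> g = ?g2" using inv2 ne by blast
        have gg2: "g \<star> ?g2 = \<zero>" "?g2 \<star> g = \<zero>" using g4 by (simp_all add: star_add_right star_add_left gg)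
        have g2g2: "?g2 \<star> ?g2 = \<zero>" using gg2 by (simp add: star_add_left[of ?g2 g g])
        have "t \<otimes> t = \<zero>" if "t \<in> T" for t
        proof -
          have "?g3 \<star> ?g3 = ?g2"
            using gg2 g2g2 by (simp add: star_add_right[of _ ?g2 g] star_add_left[of _ ?g2 g] gg)
          then show ?thesis using that unfolding Teq
            by (auto simp: mult_eq g4 gg g2g2 g33)
        qed
        then have "f ` T \<subseteq> {w \<in> carrier B. w \<oplus> w = \<zero>}"
          using f(2) f0 fc Tc by (auto simp flip: f(2))
        then have "f ` T \<subseteq> {\<zero>, ?g2}" using inv2 by blast
        then have "card (f ` T) \<le> card {\<zero>, ?g2}" by (intro card_mono) auto
        also have "\<dots> \<le> 2" by (simp add: card_insert_le_m1)
        finally have "card (f ` T) \<le> 2" .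
        moreover have "inj_on f T" using f(1) Tc by (meson bij_betw_imp_inj_on inj_on_subset subsetI)
        ultimately show False using 2 by (simp add: card_image)
      qed
      show ?thesis using xy unfolding Teq by (auto simp: star_add_right star_add_left gg)
    next
      case False
      then have two: "w \<oplus> w = \<zero>" if "w \<in> T" for w using that by blast
      have sq: "w \<star> w = \<zero>" if w: "w \<in> T" for w
      proof -
        let ?v = "w \<star> w"
        note wc [simp] = Tc[OF w]
        have vT: "?v \<in> T" using Ts[OF wc w] .
        have ww: "w \<otimes> w = ?v" using two[OF w] by (simp add: mult_eq)
        have vv: "?v \<otimes> ?v = \<zero>"
          using two[OF vT] cube[of w ?v w] w by (simp add: mult_eq)
        have "f ?v = f w \<oplus> f w" using f(2)[of w w] ww by simp
        moreover have "f ?v \<oplus> f ?v = \<zero>" using f(2)[of ?v ?v] vv f0 by simp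
        ultimately have "f w \<in> T" using fc[OF wc] by (simp add: T_def pow4)
        then have "f ?v = \<zero>" using two \<open>f ?v = f w \<oplus> f w\<close> by simp
        then show ?thesis using fz by simp
      qed
      show ?thesis
      proof (rule ccontr)
        let ?w = "x \<star> y"
        assume ne: "?w \<noteq> \<zero>"
        note [simp] = Tc[OF xy(1)] Tc[OF xy(2)]
        have nz: "x \<noteq> \<zero>" "y \<noteq> \<zero>" using ne by auto
        have xney: "x \<noteq> y" using ne sq xy by auto
        have s0: "x \<oplus> y \<noteq> \<zero>"
          using double_involution[of x y] two[OF xy(1)] xney by auto
        have wx: "?w \<noteq> x" using cube[of x y y] ne xy by (metis star_comm star_assoc Tc)
        have wy: "?w \<noteq> y" using cube[of x x y] ne xy by (metis Tc)
        have ws: "?w \<noteq> x \<oplus> y"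
        proof
          assume "?w = x \<oplus> y"
          then have "y \<star> ?w = y \<star> (x \<oplus> y)" by simp
          then show False using cube[of x y y] xy ne sq[OF xy(2)]
            by (simp add: star_add_right star_comm[of y x])
        qed
        have "{\<zero>, x, y, x \<oplus> y, ?w} \<subseteq> T" using T0 xy Ta Ts by auto
        then have "card {\<zero>, x, y, x \<oplus> y, ?w} \<le> 4" using 2 finT by (metis card_mono)
        moreover have "card {\<zero>, x, y, x \<oplus> y, ?w} = 5"
          using nz xney s0 wx wy ws ne by (auto simp: eq_commute[of \<zero>] eq_commute[of x "x \<star> y"] eq_commute[of y "x \<star> y"] eq_commute[of "x \<oplus> y" "x \<star> y"])
        ultimately show False by simp
      qed
    qed
  qed
qed

text \<open>
  If \<open>x \<star> y\<close> is not zero, some prime \<open>p\<close> divides its additive order. Multiplying \<open>x\<close> and \<open>y\<close> by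
  the part \<open>m\<close> of the order of the group that is prime to \<open>p\<close> moves both into the \<open>p\<close>-primary
  component and keeps the product nonzero. But that component has order at most \<open>p\<close>, or at most 4 if
  \<open>p = 2\<close>, and then its products vanish.
\<close>

theorem trivial_brace:
  assumes fin: "finite (carrier B)"
    and f: "bij_betw f (carrier B) (carrier B)"
      "\<And>x y. x \<in> carrier B \<Longrightarrow> y \<in> carrier B \<Longrightarrow> f (x \<otimes> y) = f x \<oplus> f y"
    and odd_part: "\<And>p. Factorial_Ring.prime p \<Longrightarrow> odd p \<Longrightarrow> \<not> p ^ 2 dvd card (carrier B)"
    and even_part: "\<not> 8 dvd card (carrier B)"
    and xy: "x \<in> carrier B" "y \<in> carrier B"
  shows "x \<otimes> y = x \<oplus> y"
proof -
  let ?n = "card (carrier B)"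
  have npos: "?n > 0" using fin xy by (auto simp: card_gt_0_iff)
  have "x \<star> y = \<zero>"
  proof (rule ccontr)
    let ?z = "x \<star> y" let ?o = "add.ord (x \<star> y)"
    assume ne: "?z \<noteq> \<zero>"
    have "?o \<noteq> 1" using ne add.ord_eq_1 xy by auto
    then obtain p where p: "Factorial_Ring.prime p" "p dvd ?o" using prime_factor_nat by blast
    obtain a m where am: "?n = p ^ a * m" "\<not> p dvd m"
      using multiplicity_decompose'[of ?n p] npos p(1)
      by (metis mult.commute not_prime_unit neq0_conv)
    let ?T = "{x \<in> carrier B. add_pow B (p ^ a) x = \<zero>}"
    have T: "brace_ideal ?T" by (rule brace_ideal_torsion)
    have cT: "card ?T dvd p ^ a"
      using add.card_primary_torsion_dvd[of p a m] fin p am by (simp add: order_def)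
    have mT: "add_pow B m u \<in> ?T" if "u \<in> carrier B" for u
      using that add.pow_order_eq_1[of u] fin am
      by (simp add: order_def add.nat_pow_pow mult.commute)
    have "add_pow B m x \<star> add_pow B m y = \<zero>"
    proof (cases "odd p \<or> a < 2")
      case True
      have "a < 2"
      proof (rule ccontr)
        assume "\<not> a < 2"
        then have "p ^ 2 dvd ?n" using am by (simp add: le_imp_power_dvd dvd_mult2)
        then show False using odd_part[OF p(1)] True \<open>\<not> a < 2\<close> by blast
      qed
      then have "p ^ a dvd p" by (cases a) auto
      then show ?thesis
        using star_prime_ideal[OF fin T p(1) dvd_trans[OF cT]] mT xy by blast
    next
      case False
      then have p2: "p = 2" using primes_dvd_imp_eq[OF two_is_prime_nat p(1)] by simp
      have "a = 2"
      proof (rule ccontr)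
        assume "a \<noteq> 2"
        then have "2 ^ 3 dvd ?n" using am False p2 by (simp only:) (rule dvd_mult2, rule le_imp_power_dvd, simp)
        then show False using even_part by simp
      qed
      then have "p ^ a = 4" using p2 by simp
      then show ?thesis
        using star_four_torsion[OF fin refl _ f] mT xy cT by simp
    qed
    then have "add_pow B (m * m) ?z = \<zero>"
      using xy by (simp add: star_add_pow star_comm[of "add_pow B m x" y] add.nat_pow_pow star_comm[of y x])
    then have "?o dvd m * m" using xy add.pow_eq_id by auto
    then have "p dvd m * m" using p(2) by (rule dvd_trans[rotated])
    then show False using p(1) am(2) by (simp add: prime_dvd_mult_iff)
  qed
  then show ?thesis using mult_eq xy by simp
qed
end

section \<open>Uniqueness of the regular subgroup\<close>

text \<open>
  Write \<open>pt x\<close> for the element of \<open>R\<close> that moves the neutral element to \<open>x\<close>. The operation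
  \<open>pt x y\<close> is the group structure that regularity transports from \<open>R\<close> to the carrier, and it is
  isomorphic to \<open>G\<close>. That \<open>R\<close> is normalized by translations says exactly that this operation and the
  one of \<open>G\<close> form a commutative brace. As that brace is trivial, \<open>pt x\<close> is the translation by \<open>x\<close>.
\<close>

lemma (in comm_group) regular_normalized_imp_left_reg:
  assumes fin: "finite (carrier G)"
    and odd_part: "\<And>p. Factorial_Ring.prime p \<Longrightarrow> odd p \<Longrightarrow> \<not> p ^ 2 dvd card (carrier G)"
    and even_part: "\<not> 8 dvd card (carrier G)"
    and reg: "regular_subgroup G R" and iso: "(Perm G)\<lparr>carrier := R\<rparr> \<cong> G"
    and norm: "normalized_by_left_reg G R"
  shows "R = left_reg G ` carrier G"
proof -
  interpret P: group "Perm G" by (rule group_Perm)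
  have R: "subgroup R (Perm G)" and ev: "bij_betw (\<lambda>\<eta>. \<eta> \<one>) R (carrier G)"
    using reg by (auto simp: regular_subgroup_def)
  interpret PR: group "(Perm G)\<lparr>carrier := R\<rparr>" using R by (rule P.subgroup_imp_group)
  have RB: "h \<in> Bij (carrier G)" if "h \<in> R" for h
    using subgroup.mem_carrier[OF R that] by (simp add: Perm_simps)
  have Rc: "h x \<in> carrier G" if "h \<in> R" "x \<in> carrier G" for h x
    using Bij_closed[OF RB] that by simp
  define pt where "pt = inv_into R (\<lambda>\<eta>. \<eta> \<one>)"
  have pt: "pt x \<in> R" "pt x \<one> = x" if "x \<in> carrier G" for x
    using ev that unfolding pt_def
    by (auto simp: bij_betw_def inv_into_into f_inv_into_f[of x "\<lambda>\<eta>. \<eta> \<one>"])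
  have pt_eq: "pt (h \<one>) = h" if "h \<in> R" for h
    using inv_into_f_f[OF bij_betw_imp_inj_on[OF ev] that] by (simp add: pt_def)
  have pt_mult: "h (k x) = pt (h (k \<one>)) x" if "h \<in> R" "k \<in> R" "x \<in> carrier G" for h k x
  proof -
    have "h \<otimes>\<^bsub>Perm G\<^esub> k \<in> R" using subgroup.m_closed[OF R] that by blast
    from pt_eq[OF this] show ?thesis using that RB
      by (metis Perm_mult_apply one_closed)
  qed
  obtain i where i: "i \<in> Group.iso G ((Perm G)\<lparr>carrier := R\<rparr>)"
    using PR.iso_sym[OF iso] by (auto simp: is_iso_def)
  then have ihom: "i (x \<otimes> y) = i x \<otimes>\<^bsub>Perm G\<^esub> i y" if "x \<in> carrier G" "y \<in> carrier G" for x y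
    using that by (auto simp: iso_def hom_def)
  have ibij: "bij_betw i (carrier G) R" using i by (simp add: iso_def)
  then have iR: "i x \<in> R" if "x \<in> carrier G" for x using that by (auto simp: bij_betw_def)
  have comm: "h (k x) = k (h x)" if hk: "h \<in> R" "k \<in> R" and x: "x \<in> carrier G" for h k x
  proof -
    obtain a b where ab: "a \<in> carrier G" "h = i a" "b \<in> carrier G" "k = i b"
      using ibij hk by (auto simp: bij_betw_def)
    then have "h \<otimes>\<^bsub>Perm G\<^esub> k = k \<otimes>\<^bsub>Perm G\<^esub> h" by (metis ihom m_comm)
    then show ?thesis using hk x RB by (metis Perm_mult_apply)
  qed
  define B where "B = \<lparr>carrier = carrier G, monoid.mult = (\<otimes>), one = \<one>, ring.zero = \<one>, add = pt\<rparr>"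
  have B [simp]: "carrier B = carrier G" "x \<otimes>\<^bsub>B\<^esub> y = x \<otimes> y" "\<one>\<^bsub>B\<^esub> = \<one>" "\<zero>\<^bsub>B\<^esub> = \<one>" "x \<oplus>\<^bsub>B\<^esub> y = pt x y" for x y
    by (simp_all add: B_def)
  have pt_comm: "pt x y = pt y x" if "x \<in> carrier G" "y \<in> carrier G" for x y
    using comm[of "pt x" "pt y" \<one>] pt that by simp
  have pt_assoc: "pt (pt x y) z = pt x (pt y z)" if "x \<in> carrier G" "y \<in> carrier G" "z \<in> carrier G" for x y z
    using pt_mult[of "pt x" "pt y" z] pt that by simp
  interpret BG: comm_group B
    by (rule comm_groupI) (auto simp: m_ac intro: bexI[of _ "inv _"] l_inv)
  interpret BA: abelian_group B
  proof (rule abelian_groupI)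
    show "\<zero>\<^bsub>B\<^esub> \<oplus>\<^bsub>B\<^esub> x = x" if "x \<in> carrier B" for x
      using that pt_comm[of \<one> x] pt by simp
    show "\<exists>y\<in>carrier B. y \<oplus>\<^bsub>B\<^esub> x = \<zero>\<^bsub>B\<^esub>" if "x \<in> carrier B" for x
    proof -
      have "\<one> \<in> pt x ` carrier G" using RB[OF pt(1)] that by (auto simp: Bij_def bij_betw_def)
      then obtain y where "y \<in> carrier G" "pt x y = \<one>" by auto
      then show ?thesis using that pt_comm[of x y] by auto
    qed
  qed (use Rc pt pt_comm pt_assoc in auto)
  interpret BB: comm_brace B
  proof unfold_locales
    fix a x y assume "a \<in> carrier B" "x \<in> carrier B" "y \<in> carrier B"
    then have c: "a \<in> carrier G" "x \<in> carrier G" "y \<in> carrier G" by auto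
    obtain h where h: "h \<in> R" "\<And>z. z \<in> carrier G \<Longrightarrow> a \<otimes> pt x z = h (a \<otimes> z)"
      using norm c pt(1)[OF c(2)] unfolding normalized_by_left_reg_iff[OF R] by blast
    have h1: "a \<otimes> x = h a" using h(2)[of \<one>] c pt by simp
    have "pt (a \<otimes> pt x y) a = pt (h (a \<otimes> y)) a" using h c by simp
    also have "\<dots> = pt a (h (a \<otimes> y))" using h c Rc by (intro pt_comm) auto
    also have "\<dots> = h (pt a (a \<otimes> y))" using comm[OF h(1) pt(1)[OF c(1)], of "a \<otimes> y"] c by simp
    also have "\<dots> = pt (a \<otimes> x) (a \<otimes> y)"
      using pt_mult[OF h(1) pt(1)[OF c(1)], of "a \<otimes> y"] c pt h1 by simp
    finally show "a \<otimes>\<^bsub>B\<^esub> (x \<oplus>\<^bsub>B\<^esub> y) \<oplus>\<^bsub>B\<^esub> a = (a \<otimes>\<^bsub>B\<^esub> x) \<oplus>\<^bsub>B\<^esub> (a \<otimes>\<^bsub>B\<^esub> y)" by simp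
  qed
  have trivial: "x \<otimes> y = pt x y" if "x \<in> carrier G" "y \<in> carrier G" for x y
  proof -
    have "bij_betw (\<lambda>a. i a \<one>) (carrier B) (carrier B)"
      using bij_betw_trans[OF ibij ev] by (simp add: comp_def)
    moreover have "i (x \<otimes>\<^bsub>B\<^esub> y) \<one> = i x \<one> \<oplus>\<^bsub>B\<^esub> i y \<one>" if "x \<in> carrier B" "y \<in> carrier B" for x y
      using that ihom pt_eq iR RB by (simp add: Perm_mult_apply)
    ultimately show ?thesis
      using BB.trivial_brace[of "\<lambda>a. i a \<one>" x y] fin odd_part even_part that by simp
  qed
  have left: "pt x = left_reg G x" if "x \<in> carrier G" for x
    using that pt RB by (intro Bij_ext[of _ "carrier G"]) (auto simp: left_reg_Bij left_reg_apply trivial)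
  have "R = pt ` carrier G"
  proof
    show "R \<subseteq> pt ` carrier G"
      using pt_eq Rc by (metis image_eqI one_closed subsetI)
  qed (use pt in auto)
  then show ?thesis using left by (simp cong: image_cong)
qed

section \<open>Twisting the left regular representation by a quadratic map\<close>

lemma (in comm_group) left_reg_counted:
  shows "regular_subgroup G (left_reg G ` carrier G)"
    and "(Perm G)\<lparr>carrier := left_reg G ` carrier G\<rparr> \<cong> G"
    and "normalized_by_left_reg G (left_reg G ` carrier G)"
proof -
  have eq: "left_reg G = transported_reg G (\<lambda>x. x) (\<lambda>x. x)"
    by (simp add: fun_eq_iff left_reg_def transported_reg_def)
  show reg: "regular_subgroup G (left_reg G ` carrier G)"
    unfolding eq by (rule transported_reg_regular) auto
  show "(Perm G)\<lparr>carrier := left_reg G ` carrier G\<rparr> \<cong> G"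
    unfolding eq by (rule transported_reg_iso) auto
  have R: "subgroup (left_reg G ` carrier G) (Perm G)" using reg by (simp add: regular_subgroup_def)
  show "normalized_by_left_reg G (left_reg G ` carrier G)"
    unfolding normalized_by_left_reg_iff[OF R]
  proof (intro ballI)
    fix b \<eta> assume b: "b \<in> carrier G" and "\<eta> \<in> left_reg G ` carrier G"
    then obtain a where "a \<in> carrier G" "\<eta> = left_reg G a" by blast
    with b show "\<exists>\<eta>'\<in>left_reg G ` carrier G. \<forall>z\<in>carrier G. b \<otimes> \<eta> z = \<eta>' (b \<otimes> z)"
      by (intro bexI[of _ \<eta>]) (auto simp: left_reg_apply m_lcomm)
  qed
qed

text \<open>
  The map \<open>\<phi> x = x \<otimes> Q x\<close> has the inverse \<open>\<psi> x = x \<otimes> inv (Q x)\<close>, because \<open>Q\<close> does not change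
  along its own values. The assumption \<open>cube\<close> says that
  \<open>Q (x \<otimes> y) \<otimes> inv (Q x) \<otimes> inv (Q y)\<close> is bimultiplicative, so \<open>Q\<close> is quadratic.
  For a translation \<open>\<tau>\<close> the map \<open>\<psi> \<circ> \<tau> \<circ> \<phi>\<close> is therefore affine and normalizes the left regular
  representation; so \<open>\<tau>\<close> normalizes the conjugate of that representation by \<open>\<phi>\<close>. This conjugate differs from the left regular
  representation since \<open>\<phi>\<close> is not a homomorphism.
\<close>

lemma (in comm_group) quadratic_twist:
  assumes Q: "\<And>x. x \<in> carrier G \<Longrightarrow> Q x \<in> carrier G"
    and inv: "\<And>x y. x \<in> carrier G \<Longrightarrow> y \<in> carrier G \<Longrightarrow> Q (x \<otimes> Q y) = Q x"
    and cube: "\<And>x y z. x \<in> carrier G \<Longrightarrow> y \<in> carrier G \<Longrightarrow> z \<in> carrier G \<Longrightarrow>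
        Q (x \<otimes> y \<otimes> z) \<otimes> (Q x \<otimes> Q y \<otimes> Q z) = Q (x \<otimes> y) \<otimes> Q (y \<otimes> z) \<otimes> Q (x \<otimes> z)"
    and ab: "a\<^sub>0 \<in> carrier G" "b\<^sub>0 \<in> carrier G" "Q (a\<^sub>0 \<otimes> b\<^sub>0) \<noteq> Q a\<^sub>0 \<otimes> Q b\<^sub>0"
  shows "e_count G G \<noteq> 1"
proof -
  define \<phi> where "\<phi> x = x \<otimes> Q x" for x
  define \<psi> where "\<psi> x = x \<otimes> inv (Q x)" for x
  define R where "R = transported_reg G \<phi> \<psi> ` carrier G"
  have inv': "Q (x \<otimes> inv (Q y)) = Q x" if "x \<in> carrier G" "y \<in> carrier G" for x y
    using inv[of "x \<otimes> inv (Q y)" y] Q that by (simp add: m_assoc)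
  have \<phi>c: "\<phi> x \<in> carrier G" and \<psi>c: "\<psi> x \<in> carrier G"
    and \<psi>\<phi>: "\<psi> (\<phi> x) = x" and \<phi>\<psi>: "\<phi> (\<psi> x) = x" if "x \<in> carrier G" for x
    using that Q by (simp_all add: \<phi>_def \<psi>_def inv inv' m_assoc)
  have reg: "regular_subgroup G R" and iso: "(Perm G)\<lparr>carrier := R\<rparr> \<cong> G"
    unfolding R_def using \<phi>c \<psi>c \<psi>\<phi> \<phi>\<psi>
    by (intro transported_reg_regular transported_reg_iso; simp)+
  have R: "subgroup R (Perm G)" using reg by (simp add: regular_subgroup_def)
  have app: "transported_reg G \<phi> \<psi> a x = \<phi> (a \<otimes> \<psi> x)" if "x \<in> carrier G" for a x
    using that by (simp add: transported_reg_def)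
  have cancel: "p \<otimes> q \<otimes> r \<otimes> inv p \<otimes> inv q = r"
    if "p \<in> carrier G" "q \<in> carrier G" "r \<in> carrier G" for p q r
  proof -
    have "p \<otimes> q \<otimes> r \<otimes> inv p \<otimes> inv q = (p \<otimes> inv p) \<otimes> ((q \<otimes> inv q) \<otimes> r)"
      using that by (simp add: m_ac del: r_inv Units_r_inv)
    then show ?thesis using that by simp
  qed
  have norm: "normalized_by_left_reg G R"
    unfolding normalized_by_left_reg_iff[OF R]
  proof (intro ballI)
    fix b \<eta> assume b: "b \<in> carrier G" and "\<eta> \<in> R"
    then obtain a where a: "a \<in> carrier G" "\<eta> = transported_reg G \<phi> \<psi> a" unfolding R_def by blast
    \<comment> \<open>Conjugation by the translation by \<open>b\<close> replaces \<open>a\<close> by \<open>a \<otimes> c\<close>, where \<open>c\<close> is the inverse of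
      the value at \<open>(a, b)\<close> of the bilinear form of \<open>Q\<close>.\<close>
    define c where "c = Q a \<otimes> Q b \<otimes> inv (Q (a \<otimes> b))"
    have cc: "c \<in> carrier G" using a b Q by (simp add: c_def)
    have "b \<otimes> \<phi> (a \<otimes> \<psi> z) = \<phi> (a \<otimes> c \<otimes> \<psi> (b \<otimes> z))" if z: "z \<in> carrier G" for z
    proof -
      define y where "y = \<psi> z"
      have y: "y \<in> carrier G" and zy: "z = y \<otimes> Q y"
        using z \<psi>c \<phi>\<psi> by (auto simp: y_def \<phi>_def[symmetric])
      define E where "E = c \<otimes> (Q y \<otimes> inv (Q (b \<otimes> y)))"
      have Ec: "E \<in> carrier G" using cc y b Q by (simp add: E_def)
      have "\<psi> (b \<otimes> z) = b \<otimes> y \<otimes> (Q y \<otimes> inv (Q (b \<otimes> y)))"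
        using inv[of "b \<otimes> y" y] b y Q by (simp add: \<psi>_def zy m_assoc)
      then have arg: "a \<otimes> c \<otimes> \<psi> (b \<otimes> z) = a \<otimes> b \<otimes> y \<otimes> E"
        using a b y cc Q by (simp add: E_def m_ac)
      have QE: "Q (a \<otimes> b \<otimes> y \<otimes> E) = Q (a \<otimes> b \<otimes> y)"
        using a b y Q by (simp add: E_def c_def inv inv' flip: m_assoc)
      have "E \<otimes> Q (a \<otimes> b \<otimes> y)
          = Q (a \<otimes> b \<otimes> y) \<otimes> (Q a \<otimes> Q b \<otimes> Q y) \<otimes> inv (Q (a \<otimes> b)) \<otimes> inv (Q (b \<otimes> y))"
        unfolding E_def c_def
        using a b y Q[of "a \<otimes> b \<otimes> y"] Q[of "a \<otimes> b"] Q[of "b \<otimes> y"] Q[of a] Q[of b] Q[of y]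
        by (simp add: m_ac)
      also have "\<dots> = Q (a \<otimes> y)"
        unfolding cube[OF a(1) b y] using a b y Q by (intro cancel) auto
      finally have "\<phi> (a \<otimes> c \<otimes> \<psi> (b \<otimes> z)) = a \<otimes> b \<otimes> y \<otimes> Q (a \<otimes> y)"
        unfolding arg \<phi>_def QE using a b y Q Ec by (simp add: m_assoc)
      also have "\<dots> = b \<otimes> \<phi> (a \<otimes> y)" using a b y Q[of "a \<otimes> y"] by (simp add: \<phi>_def m_ac)
      finally show ?thesis by (simp add: y_def)
    qed
    then show "\<exists>\<eta>'\<in>R. \<forall>z\<in>carrier G. b \<otimes> \<eta> z = \<eta>' (b \<otimes> z)"
      using a b cc by (intro bexI[of _ "transported_reg G \<phi> \<psi> (a \<otimes> c)"]) (auto simp: app R_def)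
  qed
  have "R \<noteq> left_reg G ` carrier G"
  proof
    assume "R = left_reg G ` carrier G"
    then have "transported_reg G \<phi> \<psi> a\<^sub>0 \<in> left_reg G ` carrier G" using ab(1) unfolding R_def by blast
    then obtain c where c: "c \<in> carrier G" "transported_reg G \<phi> \<psi> a\<^sub>0 = left_reg G c" by blast
    then have mult: "\<phi> (a\<^sub>0 \<otimes> \<psi> x) = c \<otimes> x" if "x \<in> carrier G" for x
      using app[OF that, of a\<^sub>0] that by (simp add: left_reg_apply)
    have "Q \<one> = \<one>" using cube[of \<one> \<one> \<one>] Q[of \<one>] by (simp add: m_assoc)
    then have "\<phi> \<one> = \<one>" "\<psi> \<one> = \<one>" by (simp_all add: \<phi>_def \<psi>_def)
    then have "c = \<phi> a\<^sub>0" using mult[of \<one>] ab c by simp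
    then have "\<phi> (a\<^sub>0 \<otimes> b\<^sub>0) = \<phi> a\<^sub>0 \<otimes> \<phi> b\<^sub>0" using mult[of "\<phi> b\<^sub>0"] ab \<psi>\<phi> \<phi>c by simp
    then have "(a\<^sub>0 \<otimes> b\<^sub>0) \<otimes> Q (a\<^sub>0 \<otimes> b\<^sub>0) = (a\<^sub>0 \<otimes> b\<^sub>0) \<otimes> (Q a\<^sub>0 \<otimes> Q b\<^sub>0)"
      using ab(1,2) Q[of a\<^sub>0] Q[of b\<^sub>0] by (simp add: \<phi>_def m_ac)
    then show False using ab Q by (metis l_cancel m_closed)
  qed
  moreover define S where "S = {R. regular_subgroup G R \<and> (Perm G)\<lparr>carrier := R\<rparr> \<cong> G \<and> normalized_by_left_reg G R}"
  have "R \<in> S" "left_reg G ` carrier G \<in> S"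
    using reg iso norm left_reg_counted by (simp_all add: S_def)
  ultimately have "card S \<noteq> 1" by (metis card_1_singletonE singletonD)
  then show ?thesis by (simp add: e_count_def S_def)
qed

lemma (in group) pow_eq_iff_cong:
  assumes u: "u \<in> carrier G" "u \<noteq> \<one>" "u [^] p = \<one>" and p: "Factorial_Ring.prime (p::nat)"
  shows "u [^] (i::nat) = u [^] (j::nat) \<longleftrightarrow> [i = j] (mod p)"
proof -
  have "ord u dvd p" using u pow_eq_id by blast
  then have "ord u = p" using p u ord_eq_1[of u] by (auto simp: prime_nat_iff)
  then have "u [^] int i = u [^] int j \<longleftrightarrow> int p dvd int j - int i"
    using int_pow_eq[OF u(1), of "int i" "int j"] by simp
  then show ?thesis by (simp add: int_pow_int cong_iff_dvd_diff dvd_diff_commute[of "int p" "int j"] flip: cong_int_iff)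
qed

text \<open>
  The quadratic map \<open>Q x = u [^] q x\<close> takes its values in a subgroup of order \<open>p\<close>, so that all conditions
  on it become congruences for the exponent \<open>q\<close>.
\<close>

lemma (in comm_group) quadratic_exponent_twist:
  fixes q :: "'a \<Rightarrow> nat"
  assumes p: "Factorial_Ring.prime p" and u: "u \<in> carrier G" "u \<noteq> \<one>" "u [^] p = \<one>"
    and inv: "\<And>x. x \<in> carrier G \<Longrightarrow> [q (x \<otimes> u) = q x] (mod p)"
    and cube: "\<And>x y z. x \<in> carrier G \<Longrightarrow> y \<in> carrier G \<Longrightarrow> z \<in> carrier G \<Longrightarrow>
        [q (x \<otimes> y \<otimes> z) + (q x + q y + q z) = q (x \<otimes> y) + q (y \<otimes> z) + q (x \<otimes> z)] (mod p)"
    and ab: "a \<in> carrier G" "b \<in> carrier G" "\<not> [q (a \<otimes> b) = q a + q b] (mod p)"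
  shows "e_count G G \<noteq> 1"
proof (rule quadratic_twist[where Q = "\<lambda>x. u [^] q x"])
  note eq = pow_eq_iff_cong[OF u p]
  have step: "[q (x \<otimes> u [^] k) = q x] (mod p)" if x: "x \<in> carrier G" for x and k :: nat
  proof (induction k)
    case (Suc k)
    have "[q (x \<otimes> u [^] k \<otimes> u) = q (x \<otimes> u [^] k)] (mod p)" using inv x u by simp
    with Suc show ?case using x u by (simp add: m_assoc) (metis cong_trans)
  qed (use x in simp)
  show "u [^] q (x \<otimes> u [^] q y) = u [^] q x" if "x \<in> carrier G" for x y
    unfolding eq using step that by blast
  show "u [^] q (x \<otimes> y \<otimes> z) \<otimes> (u [^] q x \<otimes> u [^] q y \<otimes> u [^] q z)
      = u [^] q (x \<otimes> y) \<otimes> u [^] q (y \<otimes> z) \<otimes> u [^] q (x \<otimes> z)"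
    if "x \<in> carrier G" "y \<in> carrier G" "z \<in> carrier G" for x y z
    using cube[OF that] u(1) by (simp only: nat_pow_mult nat_pow_closed eq)
  show "u [^] q (a \<otimes> b) \<noteq> u [^] q a \<otimes> u [^] q b"
    using ab u(1) by (simp only: nat_pow_mult eq not_False_eq_True)
qed (use u ab in auto)

section \<open>Characters with values in the integers modulo m\<close>

text \<open>
  A homomorphism to the integers modulo \<open>m\<close>, given by natural numbers that represent its values: they will
  occur inside binomial coefficients and as exponents.
\<close>

definition char_mod :: "('a, 'm) monoid_scheme \<Rightarrow> nat \<Rightarrow> ('a \<Rightarrow> nat) \<Rightarrow> bool" where
  "char_mod G m \<chi> \<longleftrightarrow> (\<forall>x\<in>carrier G. \<forall>y\<in>carrier G. [\<chi> (x \<otimes>\<^bsub>G\<^esub> y) = \<chi> x + \<chi> y] (mod m))"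

lemma char_mod_mult:
  "char_mod G m \<chi> \<Longrightarrow> x \<in> carrier G \<Longrightarrow> y \<in> carrier G \<Longrightarrow> [\<chi> (x \<otimes>\<^bsub>G\<^esub> y) = \<chi> x + \<chi> y] (mod m)"
  by (simp add: char_mod_def)

lemma (in group) char_mod_one:
  assumes "char_mod G m \<chi>" shows "[\<chi> \<one> = 0] (mod m)"
  using cong_sym[OF char_mod_mult[OF assms, of \<one> \<one>]] by (simp add: cong_add_lcancel_0_nat)

lemma (in group) char_mod_pow:
  assumes "char_mod G m \<chi>" "x \<in> carrier G" shows "[\<chi> (x [^] (n::nat)) = n * \<chi> x] (mod m)"
proof (induction n)
  case 0
  then show ?case using char_mod_one[OF assms(1)] by simp
next
  case (Suc n)
  have "[\<chi> (x [^] n \<otimes> x) = \<chi> (x [^] n) + \<chi> x] (mod m)" using char_mod_mult[OF assms(1)] assms(2) by simp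
  also have "[\<chi> (x [^] n) + \<chi> x = n * \<chi> x + \<chi> x] (mod m)" using Suc by (rule cong_add) simp
  finally show ?case by (simp add: add.commute)
qed

lemma (in group) hom_char_mod:
  assumes "char_mod G m \<chi>" "m > 0"
  shows "(\<lambda>x. int (\<chi> x) mod int m) \<in> hom G (integer_mod_group m)"
proof (rule homI)
  show "int (\<chi> x) mod int m \<in> carrier (integer_mod_group m)" for x
    using assms(2) by (simp add: carrier_integer_mod_group)
  show "int (\<chi> (x \<otimes> y)) mod int m = (int (\<chi> x) mod int m) \<otimes>\<^bsub>integer_mod_group m\<^esub> (int (\<chi> y) mod int m)"
    if "x \<in> carrier G" "y \<in> carrier G" for x y
    using char_mod_mult[OF assms(1) that] assms(2)
    by (simp add: mult_integer_mod_group cong_def mod_add_eq flip: of_nat_add of_nat_mod)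
qed

text \<open>
  The order of the group is the product of the orders of the kernel and of the image. The image is too small
  for its order to be divisible by \<open>p ^ k\<close>, hence \<open>p\<close> divides the order of the kernel.
\<close>

lemma (in group) torsion_in_kernel:
  assumes fin: "finite (carrier G)" and H: "group H" and f: "f \<in> hom G H"
    and p: "Factorial_Ring.prime p" "p ^ k dvd order G" and small: "card (f ` carrier G) < p ^ k"
  obtains u where "u \<in> carrier G" "u \<noteq> \<one>" "u [^] p = \<one>" "f u = \<one>\<^bsub>H\<^esub>"
proof -
  interpret H: group H by (rule H)
  interpret f: group_hom G H f using f by unfold_locales
  let ?K = "kernel G H f"
  have K: "subgroup ?K G" by (rule f.subgroup_kernel)
  interpret K: group "G\<lparr>carrier := ?K\<rparr>" using K by (rule subgroup_imp_group)
  have "f ` carrier G = (\<lambda>C. the_elem (f ` C)) ` carrier (G Mod ?K)"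
  proof -
    interpret fi: group_hom G "H\<lparr>carrier := f ` carrier G\<rparr>" f
      using f.img_is_subgroup H.subgroup_imp_group f
      by (auto simp: group_hom_def group_hom_axioms_def hom_def is_group)
    have "kernel G (H\<lparr>carrier := f ` carrier G\<rparr>) f = ?K" by (simp add: kernel_def)
    then show ?thesis using fi.FactGroup_onto by simp
  qed
  moreover have "inj_on (\<lambda>C. the_elem (f ` C)) (carrier (G Mod ?K))"
    by (rule f.FactGroup_inj_on)
  ultimately have "card (f ` carrier G) = card (carrier (G Mod ?K))" by (simp add: card_image)
  with lagrange[OF K] have card: "card (f ` carrier G) * card ?K = order G" by (simp add: FactGroup_def)
  have "p dvd card ?K"
  proof (rule ccontr)
    assume "\<not> p dvd card ?K"
    then have "coprime (p ^ k) (card ?K)" using p(1) by (simp add: prime_imp_coprime)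
    then have "p ^ k dvd card (f ` carrier G)" using p(2) card by (metis coprime_dvd_mult_left_iff)
    moreover have "card (f ` carrier G) > 0" using fin by (auto simp: card_gt_0_iff)
    ultimately show False using small by (simp add: dvd_imp_le leD)
  qed
  moreover have "finite ?K" using fin K finite_subset subgroup.subset by blast
  ultimately obtain u where "u \<in> ?K" "u \<noteq> \<one>" "u [^]\<^bsub>G\<lparr>carrier := ?K\<rparr>\<^esub> p = \<one>"
    using K.Cauchy[of p] p(1) by (auto simp: order_def)
  then show ?thesis using that by (auto simp: kernel_def simp flip: nat_pow_consistent)
qed

lemma (in group) torsion_in_char_kernel:
  assumes fin: "finite (carrier G)" and \<chi>: "char_mod G m \<chi>" "m > 0"
    and p: "Factorial_Ring.prime p" "p ^ k dvd order G" and small: "m < p ^ k"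
  obtains u where "u \<in> carrier G" "u \<noteq> \<one>" "u [^] p = \<one>" "[\<chi> u = 0] (mod m)"
proof -
  let ?f = "\<lambda>x. int (\<chi> x) mod int m"
  have "?f ` carrier G \<subseteq> {0..<int m}" using \<chi>(2) by auto
  then have "card (?f ` carrier G) \<le> m" using card_mono[of "{0..<int m}"] by fastforce
  then obtain u where "u \<in> carrier G" "u \<noteq> \<one>" "u [^] p = \<one>" "?f u = \<one>\<^bsub>integer_mod_group m\<^esub>"
    using torsion_in_kernel[OF fin group_integer_mod_group hom_char_mod[OF \<chi>] p] small by auto
  then show ?thesis using that by (simp add: cong_def flip: of_nat_mod)
qed

lemma (in group) torsion_in_two_char_kernels:
  assumes fin: "finite (carrier G)" and \<chi>: "char_mod G 2 \<chi>\<^sub>1" "char_mod G 2 \<chi>\<^sub>2"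
    and eight: "8 dvd order G"
  obtains u where "u \<in> carrier G" "u \<noteq> \<one>" "u [^] (2::nat) = \<one>" "even (\<chi>\<^sub>1 u)" "even (\<chi>\<^sub>2 u)"
proof -
  let ?Z = "integer_mod_group 2"
  let ?f = "\<lambda>x. (int (\<chi>\<^sub>1 x) mod int 2, int (\<chi>\<^sub>2 x) mod int 2)"
  have hom: "?f \<in> hom G (?Z \<times>\<times> ?Z)"
    using hom_char_mod[OF \<chi>(1)] hom_char_mod[OF \<chi>(2)] by (simp add: hom_paired)
  have "?f ` carrier G \<subseteq> {0..<2} \<times> {0..<2}" by auto
  then have "card (?f ` carrier G) \<le> 4" using card_mono[of "{0..<2::int} \<times> {0..<2::int}"] by fastforce
  moreover have "2 ^ 3 dvd order G" using eight by simp
  ultimately obtain u where "u \<in> carrier G" "u \<noteq> \<one>" "u [^] (2::nat) = \<one>" "?f u = \<one>\<^bsub>?Z \<times>\<times> ?Z\<^esub>"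
    using torsion_in_kernel[OF fin DirProd_group[OF group_integer_mod_group group_integer_mod_group] hom two_is_prime_nat, of 3]
    by auto
  moreover from this have "even (\<chi>\<^sub>1 u)" "even (\<chi>\<^sub>2 u)" by (simp, presburger)+
  ultimately show ?thesis using that by blast
qed

text \<open>
  The quotient by \<open>K\<close> is cyclic of order \<open>m\<close> and generated by the class of \<open>x\<close>; the character sends
  \<open>x [^] i \<otimes> k\<close> to \<open>i\<close>.
\<close>

lemma (in comm_group) char_mod_of_generator:
  assumes K: "subgroup K G" and x: "x \<in> carrier G" and m: "m > 0"
    and xK: "\<And>i::nat. x [^] i \<in> K \<longleftrightarrow> m dvd i"
    and cover: "\<And>y. y \<in> carrier G \<Longrightarrow> \<exists>i::nat. \<exists>k\<in>K. y = x [^] i \<otimes> k"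
  obtains \<chi> where "char_mod G m \<chi>" "[\<chi> x = 1] (mod m)"
proof -
  note Kc = subgroup.mem_carrier[OF K] and Km = subgroup.m_closed[OF K]
  have uniq: "[i = j] (mod m)" if eq: "x [^] i \<otimes> k = x [^] j \<otimes> l" and kl: "k \<in> K" "l \<in> K" for i j :: nat and k l
  proof -
    \<comment> \<open>An exponent that complements \<open>j\<close> to a multiple of \<open>m\<close>, in place of the negative exponent.\<close>
    define n where "n = j * (m - 1)"
    have "j + n = j * m" using m by (cases m) (simp_all add: n_def)
    then have jn: "m dvd j + n" by simp
    have "x [^] (i + n) \<otimes> k = x [^] n \<otimes> (x [^] i \<otimes> k)"
      using x Kc[OF kl(1)] by (simp add: m_ac flip: nat_pow_mult)
    also have "\<dots> = x [^] (j + n) \<otimes> l"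
      unfolding eq using x Kc[OF kl(2)] by (simp add: m_ac flip: nat_pow_mult)
    finally have "x [^] (i + n) \<otimes> k \<in> K" using Km[of "x [^] (j + n)" l] xK[of "j + n"] jn kl by simp
    then have "x [^] (i + n) \<otimes> k \<otimes> inv k \<in> K" using Km subgroup.m_inv_closed[OF K] kl by blast
    then have "x [^] (i + n) \<in> K" using x Kc[OF kl(1)] by (simp add: m_assoc)
    then have "[i + n = j + n] (mod m)" using xK jn by (simp add: cong_def mod_0_imp_dvd dvd_imp_mod_0)
    then show ?thesis by (simp only: cong_add_rcancel_nat)
  qed
  define \<chi> where "\<chi> y = (SOME i::nat. \<exists>k\<in>K. y = x [^] i \<otimes> k)" for y
  have \<chi>: "\<exists>k\<in>K. y = x [^] \<chi> y \<otimes> k" if "y \<in> carrier G" for y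
    unfolding \<chi>_def using cover[OF that] by (rule someI_ex)
  have "char_mod G m \<chi>"
    unfolding char_mod_def
  proof (intro ballI)
    fix y z assume yz: "y \<in> carrier G" "z \<in> carrier G"
    obtain k l n where k: "k \<in> K" "y = x [^] \<chi> y \<otimes> k" and l: "l \<in> K" "z = x [^] \<chi> z \<otimes> l"
      and n: "n \<in> K" "y \<otimes> z = x [^] \<chi> (y \<otimes> z) \<otimes> n"
      using \<chi> yz m_closed by meson
    have "y \<otimes> z = (x [^] \<chi> y \<otimes> k) \<otimes> (x [^] \<chi> z \<otimes> l)" using k(2) l(2) by simp
    also have "\<dots> = x [^] (\<chi> y + \<chi> z) \<otimes> (k \<otimes> l)"
      using x Kc[OF k(1)] Kc[OF l(1)] by (simp add: m_ac flip: nat_pow_mult)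
    finally show "[\<chi> (y \<otimes> z) = \<chi> y + \<chi> z] (mod m)"
      using uniq[of "\<chi> (y \<otimes> z)" n "\<chi> y + \<chi> z" "k \<otimes> l"] n Km k(1) l(1) by simp
  qed
  moreover have "[\<chi> x = 1] (mod m)"
  proof -
    obtain k where "k \<in> K" "x = x [^] \<chi> x \<otimes> k" using \<chi>[OF x] by blast
    then show ?thesis using uniq[of "\<chi> x" k 1 \<one>] x subgroup.one_closed[OF K] by simp
  qed
  ultimately show ?thesis by (rule that)
qed

lemma (in comm_group) subgroup_powers: "subgroup ((\<lambda>g. g [^] (n::nat)) ` carrier G) G"
proof (rule subgroupI)
  fix a b assume "a \<in> (\<lambda>g. g [^] n) ` carrier G" "b \<in> (\<lambda>g. g [^] n) ` carrier G"
  then obtain g h where gh: "g \<in> carrier G" "a = g [^] n" "h \<in> carrier G" "b = h [^] n" by blast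
  then have "a \<otimes> b = (g \<otimes> h) [^] n" by (simp add: nat_pow_distrib)
  then show "a \<otimes> b \<in> (\<lambda>g. g [^] n) ` carrier G" using gh by blast
next
  fix a assume "a \<in> (\<lambda>g. g [^] n) ` carrier G"
  then obtain g where gh: "g \<in> carrier G" "a = g [^] n" by blast
  then have "inv a = (inv g) [^] n" by (simp add: nat_pow_inv)
  then show "inv a \<in> (\<lambda>g. g [^] n) ` carrier G" using gh by blast
qed auto

text \<open>
  Take a subgroup \<open>K\<close> that contains all \<open>p\<close>-th powers and is maximal among those that avoid \<open>h\<close>. For
  \<open>y\<close> outside \<open>K\<close>, the subgroup generated by \<open>K\<close> and \<open>y\<close> contains \<open>h\<close>, so \<open>h\<close> is \<open>y [^] i\<close> times
  an element of \<open>K\<close> with \<open>i\<close> invertible modulo \<open>p\<close>; conversely \<open>y\<close> is a power of \<open>h\<close> modulo \<open>K\<close>. Thus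
  \<open>h\<close> generates the quotient by \<open>K\<close>.
\<close>

lemma (in comm_group) char_mod_prime_exists:
  assumes fin: "finite (carrier G)" and p: "Factorial_Ring.prime (p::nat)"
    and h: "h \<in> carrier G" "h \<notin> (\<lambda>g. g [^] p) ` carrier G"
  obtains \<chi> where "char_mod G p \<chi>" "[\<chi> h = 1] (mod p)"
proof -
  let ?P = "(\<lambda>g. g [^] p) ` carrier G"
  let ?C = "{K. subgroup K G \<and> ?P \<subseteq> K \<and> h \<notin> K}"
  have "?C \<subseteq> Pow (carrier G)" using subgroup.subset by blast
  then have "finite ?C" using fin by (simp add: finite_subset)
  moreover have "?P \<in> ?C" using subgroup_powers h(2) by blast
  ultimately obtain K where K: "K \<in> ?C" and max: "\<And>L. L \<in> ?C \<Longrightarrow> K \<subseteq> L \<Longrightarrow> L = K"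
    using finite_has_maximal2[of ?C ?P] by (metis (no_types, lifting))
  have Ks: "subgroup K G" and hK: "h \<notin> K" using K by auto
  note Kc = subgroup.mem_carrier[OF Ks] and Km = subgroup.m_closed[OF Ks]
  have Kp: "g [^] p \<in> K" if "g \<in> carrier G" for g using K that by blast
  have Kpow: "k [^] (n::nat) \<in> K" if "k \<in> K" for k n
    by (induction n) (use that Km subgroup.one_closed[OF Ks] in auto)
  have Kpn: "g [^] (p * n) \<in> K" if "g \<in> carrier G" for g n
    using Kpow[OF Kp[OF that], of n] that by (simp add: nat_pow_pow)
  have invp: "\<exists>j t. i * j = 1 + p * t" if "\<not> p dvd i" for i :: nat
  proof -
    have "coprime i p" using p that by (metis prime_imp_coprime coprime_commute)
    then obtain j where "[i * j = Suc 0] (mod p)" using cong_solve_coprime_nat by blast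
    then have "[i * j = 1] (mod p)" by simp
    moreover from this have "i * j \<noteq> 0"
      using \<open>[i * j = 1] (mod p)\<close> prime_gt_1_nat[OF p] by (metis cong_def mod_0 mod_less zero_neq_one)
    ultimately have ij: "i * j \<ge> 1" and "[i * j = 1] (mod p)" by auto
    then have "p dvd i * j - 1" by (simp only: cong_altdef_nat)
    then obtain t where "i * j - 1 = p * t" by blast
    then have "i * j = 1 + p * t" using ij by linarith
    then show ?thesis by blast
  qed
  have hi: "h [^] i \<in> K \<longleftrightarrow> p dvd i" for i :: nat
  proof
    assume hik: "h [^] i \<in> K"
    show "p dvd i"
    proof (rule ccontr)
      assume "\<not> p dvd i"
      then obtain j t where jt: "i * j = 1 + p * t" using invp by blast
      have "h [^] (i * j) \<in> K" using Kpow[OF hik, of j] h(1) by (simp add: nat_pow_pow)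
      then have "h \<otimes> h [^] (p * t) \<in> K" using h(1) unfolding jt by (simp add: m_comm flip: nat_pow_mult)
      then have "h \<otimes> h [^] (p * t) \<otimes> inv (h [^] (p * t)) \<in> K"
        using Km Kpn[OF h(1)] subgroup.m_inv_closed[OF Ks] by blast
      then show False using hK h(1) by (simp add: m_assoc)
    qed
  qed (use Kpn[OF h(1)] in auto)
  have cover: "\<exists>j::nat. \<exists>k\<in>K. y = h [^] j \<otimes> k" if y: "y \<in> carrier G" for y
  proof (cases "y \<in> K")
    case True
    then show ?thesis using y by (intro exI[of _ 0] bexI[of _ y]) auto
  next
    case False
    let ?L = "K <#> generate G {y}"
    have L: "subgroup ?L G" using mult_subgroups[OF Ks generate_is_subgroup] y by simp
    have KL: "K \<subseteq> ?L"
      using Kc generate.one[of G "{y}"] by (force simp: set_mult_def)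
    have yL: "y \<in> ?L"
      using y subgroup.one_closed[OF Ks] generate.incl[of y "{y}" G] by (force simp: set_mult_def)
    have "?L \<noteq> K" using yL False by blast
    then have "?L \<notin> ?C" using max KL by blast
    then have "h \<in> ?L" using L KL K by blast
    moreover have "generate G {y} = {y [^] k |k. k \<in> (UNIV :: nat set)}"
      by (rule generate_pow_on_finite_carrier[OF fin y])
    ultimately obtain k i where k: "k \<in> K" "h = k \<otimes> y [^] (i::nat)" by (auto simp: set_mult_def)
    have "\<not> p dvd i"
    proof
      assume "p dvd i"
      then have "y [^] i \<in> K" using Kpn[OF y] by auto
      then show False using k Km hK by blast
    qed
    then obtain j t where jt: "i * j = 1 + p * t" using invp by blast
    let ?k = "k [^] j \<otimes> y [^] (p * t)"
    have kK: "?k \<in> K" using Km Kpow[OF k(1)] Kpn[OF y] by blast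
    have "h [^] j = k [^] j \<otimes> y [^] (i * j)"
      unfolding k(2) using Kc[OF k(1)] y by (simp add: nat_pow_distrib nat_pow_pow)
    also have "\<dots> = y \<otimes> ?k"
      unfolding jt using Kc[OF k(1)] y by (simp add: m_ac flip: nat_pow_mult)
    finally have "y = h [^] j \<otimes> inv ?k"
      using y Kc[OF kK] h(1) by (metis inv_solve_right nat_pow_closed)
    then show ?thesis using subgroup.m_inv_closed[OF Ks kK] by blast
  qed
  show ?thesis
    using char_mod_of_generator[OF Ks h(1) _ hi cover] that p by (metis prime_gt_0_nat)
qed

text \<open>
  The power map takes the same value at \<open>u\<close> and at the neutral element; as it is not injective on the
  finite set \<open>U\<close>, it does not map \<open>U\<close> onto itself.
\<close>

lemma (in group) non_power_exists:
  assumes U: "finite U" "\<one> \<in> U" "\<And>g. g \<in> U \<Longrightarrow> g [^] (n::nat) \<in> U"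
    and u: "u \<in> U" "u \<noteq> \<one>" "u [^] n = \<one>"
  obtains h where "h \<in> U" "h \<notin> (\<lambda>g. g [^] n) ` U"
proof -
  have "\<not> inj_on (\<lambda>g. g [^] n) U" using u U(2) inj_onD[of "\<lambda>g. g [^] n" U u \<one>] by auto
  then have "(\<lambda>g. g [^] n) ` U \<noteq> U" using U(1) by (metis eq_card_imp_inj_on)
  then show ?thesis using that U(3) by blast
qed

section \<open>A second regular subgroup\<close>

lemma choose_two_add: "(a + b) choose 2 = (a choose 2) + (b choose 2) + a * (b::nat)"
proof (induction b)
  case (Suc b)
  have "Suc (a + b) choose 2 = (a + b) + ((a + b) choose 2)" "Suc b choose 2 = b + (b choose 2)"
    by (simp_all add: numeral_2_eq_2)
  then show ?case using Suc by simp
qed simp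

text \<open>
  The condition on \<open>m\<close> holds for an odd prime \<open>m = p\<close>, and for \<open>m = 4\<close> with \<open>p = 2\<close>, but not for
  \<open>m = p = 2\<close>. This is why the prime 2 needs a character modulo 4.
\<close>

lemma choose_two_cong:
  assumes m: "p dvd m" "p dvd (m choose 2)" and ab: "[a = b] (mod m)"
  shows "[a choose 2 = b choose 2] (mod (p::nat))"
proof -
  have step: "[(a + k * m) choose 2 = a choose 2] (mod p)" for a k :: nat
  proof (induction k)
    case (Suc k)
    have "(a + Suc k * m) choose 2 = ((a + k * m) choose 2) + ((m choose 2) + (a + k * m) * m)"
      using choose_two_add[of "a + k * m" m] by (simp add: algebra_simps)
    moreover have "p dvd (m choose 2) + (a + k * m) * m" using m by simp
    ultimately have "[(a + Suc k * m) choose 2 = ((a + k * m) choose 2)] (mod p)"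
      by (metis cong_add_lcancel_0_nat cong_0_iff)
    then show ?case using Suc cong_trans by blast
  qed simp
  obtain k l where "b + k * m = a + l * m"
    using ab by (metis cong_iff_lin_nat)
  then show ?thesis using step[of a l] step[of b k] by (metis cong_sym cong_trans)
qed

text \<open>
  The exponent \<open>\<chi> x choose 2\<close> is quadratic, with associated bilinear form \<open>\<chi> x * \<chi> y\<close>. The bound on
  \<open>m\<close> provides an element \<open>u\<close> of order \<open>p\<close> in the kernel of \<open>\<chi>\<close>.
\<close>

lemma (in comm_group) twist_by_choose_two:
  assumes fin: "finite (carrier G)" and p: "Factorial_Ring.prime p" "p ^ k dvd order G"
    and m: "m > 0" "m < p ^ k" "p dvd m" "p dvd (m choose 2)"
    and \<chi>: "char_mod G m \<chi>" and h: "h \<in> carrier G" "[\<chi> h = 1] (mod m)"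
  shows "e_count G G \<noteq> 1"
proof -
  obtain u where u: "u \<in> carrier G" "u \<noteq> \<one>" "u [^] p = \<one>" "[\<chi> u = 0] (mod m)"
    using torsion_in_char_kernel[OF fin \<chi> m(1) p m(2)] by blast
  note C = choose_two_cong[OF m(3,4)] and mult = char_mod_mult[OF \<chi>]
  let ?q = "\<lambda>x. \<chi> x choose 2"
  have q2: "[?q (x \<otimes> y) = (\<chi> x + \<chi> y) choose 2] (mod p)"
    if "x \<in> carrier G" "y \<in> carrier G" for x y using C[OF mult[OF that]] .
  show ?thesis
  proof (rule quadratic_exponent_twist[OF p(1) u(1-3), where q = ?q and a = h and b = h])
    fix x assume x: "x \<in> carrier G"
    have "[\<chi> (x \<otimes> u) = \<chi> x + 0] (mod m)"
      using mult[OF x u(1)] cong_add[OF cong_refl u(4), of "\<chi> x"] by (rule cong_trans)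
    then show "[?q (x \<otimes> u) = ?q x] (mod p)" using C by simp
  next
    fix x y z assume xyz: "x \<in> carrier G" "y \<in> carrier G" "z \<in> carrier G"
    have "[\<chi> (x \<otimes> y \<otimes> z) = \<chi> x + \<chi> y + \<chi> z] (mod m)"
      using mult[of "x \<otimes> y" z] cong_add[OF mult[OF xyz(1,2)] cong_refl, of "\<chi> z"] xyz
      by (meson cong_trans m_closed)
    then have "[?q (x \<otimes> y \<otimes> z) + (?q x + ?q y + ?q z)
        = ((\<chi> x + \<chi> y + \<chi> z) choose 2) + (?q x + ?q y + ?q z)] (mod p)"
      by (intro cong_add C) auto
    also have "((\<chi> x + \<chi> y + \<chi> z) choose 2) + (?q x + ?q y + ?q z)
        = ((\<chi> x + \<chi> y) choose 2) + ((\<chi> y + \<chi> z) choose 2) + ((\<chi> x + \<chi> z) choose 2)"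
      by (simp add: choose_two_add algebra_simps)
    also have "[\<dots> = ?q (x \<otimes> y) + ?q (y \<otimes> z) + ?q (x \<otimes> z)] (mod p)"
      using xyz by (intro cong_add cong_sym[OF q2])
    finally show "[?q (x \<otimes> y \<otimes> z) + (?q x + ?q y + ?q z) = ?q (x \<otimes> y) + ?q (y \<otimes> z) + ?q (x \<otimes> z)] (mod p)" .
  next
    show "\<not> [?q (h \<otimes> h) = ?q h + ?q h] (mod p)"
    proof
      assume A: "[?q (h \<otimes> h) = ?q h + ?q h] (mod p)"
      have one: "(1::nat) choose 2 = 0" and two: "(1 + 1 :: nat) choose 2 = 1"
        by (simp_all add: numeral_2_eq_2)
      have qh: "[?q h = 0] (mod p)" using C[OF h(2)] by (simp only: one)
      have "[\<chi> (h \<otimes> h) = 1 + 1] (mod m)"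
        using mult[OF h(1) h(1)] cong_add[OF h(2) h(2)] by (rule cong_trans)
      then have "[?q (h \<otimes> h) = (1 + 1) choose 2] (mod p)" by (rule C)
      then have "[1 = ?q h + ?q h] (mod p)" unfolding two using A by (metis cong_sym cong_trans)
      also have "[?q h + ?q h = 0 + 0] (mod p)" using qh qh by (rule cong_add)
      finally have "p dvd 1" by (simp add: cong_0_iff)
      then show False using p(1) by (simp add: not_prime_unit)
    qed
  qed (use h in auto)
qed

lemma (in comm_group) odd_square_twist:
  assumes fin: "finite (carrier G)" and p: "Factorial_Ring.prime p" "odd p" "p ^ 2 dvd order G"
  shows "e_count G G \<noteq> 1"
proof -
  have "p dvd order G" using p(3) by (metis dvd_trans dvd_triv_left power2_eq_square)
  then obtain u where "u \<in> carrier G" "u \<noteq> \<one>" "u [^] p = \<one>" using Cauchy[OF fin p(1)] by blast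
  then obtain h where h: "h \<in> carrier G" "h \<notin> (\<lambda>g. g [^] p) ` carrier G"
    using non_power_exists[OF fin, of p u] by auto
  obtain \<chi> where \<chi>: "char_mod G p \<chi>" "[\<chi> h = 1] (mod p)" using char_mod_prime_exists[OF fin p(1) h] by blast
  have "p choose 2 = p * ((p - 1) div 2)" using p(2) by (simp add: choose_two div_mult_swap)
  then have "p dvd (p choose 2)" by simp
  moreover have "p < p ^ 2" using prime_gt_1_nat[OF p(1)] by (simp add: power2_eq_square)
  ultimately show ?thesis
    using twist_by_choose_two[OF fin p(1,3) prime_gt_0_nat[OF p(1)] _ dvd_refl _ \<chi>(1) h(1) \<chi>(2)] by blast
qed

text \<open>
  The product of two independent characters modulo 2 is quadratic modulo 2. Their common kernel
  has index at most 4, so it still contains an element of order 2.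
\<close>

lemma (in comm_group) twist_by_product:
  assumes fin: "finite (carrier G)" and eight: "8 dvd order G"
    and \<chi>: "char_mod G 2 \<chi>\<^sub>1" "char_mod G 2 \<chi>\<^sub>2"
    and g: "g \<in> carrier G" "odd (\<chi>\<^sub>1 g)" and h: "h \<in> carrier G" "even (\<chi>\<^sub>1 h)" "odd (\<chi>\<^sub>2 h)"
  shows "e_count G G \<noteq> 1"
proof -
  obtain u where u: "u \<in> carrier G" "u \<noteq> \<one>" "u [^] (2::nat) = \<one>" "even (\<chi>\<^sub>1 u)" "even (\<chi>\<^sub>2 u)"
    using torsion_in_two_char_kernels[OF fin \<chi> eight] by blast
  have par: "even (\<chi>\<^sub>1 (x \<otimes> y)) \<longleftrightarrow> even (\<chi>\<^sub>1 x + \<chi>\<^sub>1 y)" "even (\<chi>\<^sub>2 (x \<otimes> y)) \<longleftrightarrow> even (\<chi>\<^sub>2 x + \<chi>\<^sub>2 y)"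
    if "x \<in> carrier G" "y \<in> carrier G" for x y
    using char_mod_mult[OF \<chi>(1) that] char_mod_mult[OF \<chi>(2) that] by (simp_all add: cong_dvd_iff)
  have cong2: "[a = b] (mod 2) \<longleftrightarrow> (even a \<longleftrightarrow> even b)" for a b :: nat
    by (auto simp: cong_def parity_cases even_iff_mod_2_eq_zero odd_iff_mod_2_eq_one)
  show ?thesis
    by (rule quadratic_exponent_twist[OF two_is_prime_nat u(1-3), where q = "\<lambda>x. \<chi>\<^sub>1 x * \<chi>\<^sub>2 x" and a = g and b = h])
       (use u g h in \<open>auto simp: cong2 par\<close>)
qed

text \<open>
  Let \<open>\<chi>\<close> be a character modulo 2 that does not vanish at \<open>h\<close>. If some non-square \<open>s\<close> lies in its
  kernel, there is a second character that does not vanish at \<open>s\<close>, and the product of the two serves. If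
  every element of the kernel is a square, the Sylow 2-subgroup is cyclic, and there is a character modulo 4:
  some \<open>s = y [^] 2\<close> in the kernel is not a square of an element of the kernel, and then \<open>y\<close>
  generates the quotient by the fourth powers.
\<close>

lemma (in comm_group) eight_twist:
  assumes fin: "finite (carrier G)" and eight: "8 dvd order G"
  shows "e_count G G \<noteq> 1"
proof -
  have "2 dvd order G" using eight by (rule dvd_trans[rotated]) simp
  then obtain u where "u \<in> carrier G" "u \<noteq> \<one>" "u [^] (2::nat) = \<one>"
    using Cauchy[OF fin two_is_prime_nat] by blast
  then obtain h where h: "h \<in> carrier G" "h \<notin> (\<lambda>g. g [^] (2::nat)) ` carrier G"
    using non_power_exists[OF fin, of 2 u] by auto
  obtain \<chi> where \<chi>: "char_mod G 2 \<chi>" "[\<chi> h = 1] (mod 2)"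
    using char_mod_prime_exists[OF fin two_is_prime_nat h] by blast
  have par: "even (\<chi> (x \<otimes> y)) \<longleftrightarrow> even (\<chi> x + \<chi> y)"
    if "x \<in> carrier G" "y \<in> carrier G" for x y
    using char_mod_mult[OF \<chi>(1) that] by (simp add: cong_dvd_iff)
  have par_pow: "even (\<chi> (x [^] (n::nat))) \<longleftrightarrow> even (n * \<chi> x)" if "x \<in> carrier G" for x n
    by (rule cong_dvd_iff[OF char_mod_pow[OF \<chi>(1) that]])
  have h_odd: "odd (\<chi> h)" using \<chi>(2) by (simp add: cong_dvd_iff)
  show ?thesis
  proof (cases "\<forall>s\<in>carrier G. even (\<chi> s) \<longrightarrow> s \<in> (\<lambda>g. g [^] (2::nat)) ` carrier G")
    case False
    then obtain s where s: "s \<in> carrier G" "even (\<chi> s)" "s \<notin> (\<lambda>g. g [^] (2::nat)) ` carrier G" by blast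
    obtain \<chi>' where "char_mod G 2 \<chi>'" "[\<chi>' s = 1] (mod 2)"
      using char_mod_prime_exists[OF fin two_is_prime_nat s(1,3)] by blast
    then show ?thesis
      using twist_by_product[OF fin eight \<chi>(1) _ h(1) h_odd s(1,2)] by (simp add: cong_dvd_iff)
  next
    case True
    let ?S = "{s \<in> carrier G. even (\<chi> s)}"
    have sq: "\<exists>b\<in>carrier G. a = b [^] (2::nat)" if "a \<in> carrier G" "even (\<chi> a)" for a
      using True that by blast
    have "4 dvd order G" using eight by (rule dvd_trans[rotated]) simp
    then obtain v where v: "v \<in> carrier G" "v \<noteq> \<one>" "v [^] (2::nat) = \<one>" "[\<chi> v = 0] (mod 2)"
      using torsion_in_char_kernel[OF fin \<chi>(1) _ two_is_prime_nat, of 2] by auto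
    have "\<one> \<in> ?S" using par[of \<one> \<one>] by simp
    then obtain s where s: "s \<in> ?S" "s \<notin> (\<lambda>g. g [^] (2::nat)) ` ?S"
      using non_power_exists[of ?S 2 v] fin v par_pow by (auto simp: cong_0_iff)
    obtain y where y: "y \<in> carrier G" "s = y [^] (2::nat)" using sq s by blast
    have y_odd: "odd (\<chi> y)" using s y by blast
    let ?K = "(\<lambda>g. g [^] (4::nat)) ` carrier G"
    have K: "subgroup ?K G" by (rule subgroup_powers)
    note Kc = subgroup.mem_carrier[OF K] and Km = subgroup.m_closed[OF K]
    have four: "(b [^] (2::nat)) [^] (2::nat) = b [^] (4::nat)" if "b \<in> carrier G" for b
      using that by (simp add: nat_pow_pow)
    have y4: "y [^] (4 * n) \<in> ?K" for n :: nat
      using y(1) by (intro image_eqI[of _ _ "y [^] n"]) (auto simp: nat_pow_pow mult.commute)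
    have yK: "y [^] i \<in> ?K \<longleftrightarrow> 4 dvd i" for i :: nat
    proof
      assume "y [^] i \<in> ?K"
      then obtain g where g: "g \<in> carrier G" "y [^] i = g [^] (4::nat)" by blast
      have "even (i * \<chi> y)" using par_pow[OF y(1), of i] par_pow[OF g(1), of 4] unfolding g(2) by simp
      then have "even i" using y_odd by simp
      show "4 dvd i"
      proof (rule ccontr)
        assume "\<not> 4 dvd i"
        then have "\<exists>l. i = 2 + 4 * l" using \<open>even i\<close> by presburger
        then obtain l where l: "i = 2 + 4 * l" by blast
        \<comment> \<open>From \<open>y [^] (2 + 4 * l) = g [^] 4\<close>, the element \<open>s = y [^] 2\<close> is the fourth power of \<open>?b\<close>.\<close>
        let ?b = "g \<otimes> inv (y [^] l)"
        have "s \<otimes> y [^] (4 * l) = g [^] (4::nat)" using g(2) y unfolding l by (simp add: nat_pow_mult)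
        then have "s = g [^] (4::nat) \<otimes> inv (y [^] (4 * l))" using y g by (simp add: inv_solve_right)
        also have "\<dots> = ?b [^] (4::nat)"
          using y(1) g(1) by (simp add: nat_pow_distrib nat_pow_inv nat_pow_pow mult.commute)
        also have "\<dots> = (?b [^] (2::nat)) [^] (2::nat)" using y(1) g(1) by (simp only: four inv_closed nat_pow_closed m_closed)
        finally have "s = (?b [^] (2::nat)) [^] (2::nat)" .
        moreover have "?b [^] (2::nat) \<in> ?S" using y(1) g(1) par_pow[of ?b 2] by simp
        ultimately show False using s(2) by blast
      qed
    qed (use y4 in auto)
    have cover_even: "\<exists>i::nat. \<exists>k\<in>?K. a = y [^] i \<otimes> k" if a: "a \<in> carrier G" "even (\<chi> a)" for a
    proof -
      obtain b where b: "b \<in> carrier G" "a = b [^] (2::nat)" using sq[OF a] by blast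
      show ?thesis
      proof (cases "even (\<chi> b)")
        case True
        then obtain c where "c \<in> carrier G" "b = c [^] (2::nat)" using sq b(1) by blast
        then have "a \<in> ?K" using b(2) four by blast
        then show ?thesis using a(1) by (intro exI[of _ 0] bexI[of _ a]) auto
      next
        case False
        then have "even (\<chi> (b \<otimes> y))" using par b(1) y(1) y_odd by simp
        then obtain c where c: "c \<in> carrier G" "b \<otimes> y = c [^] (2::nat)" using sq b(1) y(1) by blast
        \<comment> \<open>Modulo fourth powers \<open>a\<close> is inverse to the square of \<open>y\<close>, hence equal to it.\<close>
        have "a \<otimes> y [^] (2::nat) = c [^] (4::nat)"
          using b y(1) c by (simp add: four[symmetric] nat_pow_distrib flip: c(2))
        then have "a \<otimes> y [^] (2::nat) \<otimes> y [^] (2::nat) = y [^] (2::nat) \<otimes> c [^] (4::nat)"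
          using c(1) y(1) by (simp add: m_comm)
        then have "a \<otimes> y [^] (4::nat) = y [^] (2::nat) \<otimes> c [^] (4::nat)"
          using a(1) y(1) by (simp add: m_assoc nat_pow_mult)
        then have "a = y [^] (2::nat) \<otimes> (c [^] (4::nat) \<otimes> inv (y [^] (4::nat)))"
          using a(1) y(1) c(1) by (simp add: inv_solve_right flip: m_assoc)
        moreover have "c [^] (4::nat) \<otimes> inv (y [^] (4::nat)) \<in> ?K"
          using y4[of 1] c(1) by (intro Km subgroup.m_inv_closed[OF K]) auto
        ultimately show ?thesis by blast
      qed
    qed
    have cover: "\<exists>i::nat. \<exists>k\<in>?K. a = y [^] i \<otimes> k" if a: "a \<in> carrier G" for a
    proof (cases "even (\<chi> a)")
      case False
      then have "even (\<chi> (a \<otimes> y))" using par a y(1) y_odd by simp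
      then obtain i k where k: "k \<in> ?K" "a \<otimes> y = y [^] (i::nat) \<otimes> k" using cover_even a y(1) by blast
      have "a \<otimes> y [^] (4::nat) = a \<otimes> y \<otimes> y [^] (3::nat)"
        using a y(1) by (simp add: m_assoc nat_pow_mult numeral_eq_Suc m_comm)
      also have "\<dots> = y [^] (i + 3) \<otimes> k"
        unfolding k(2) using y(1) Kc[OF k(1)] by (simp add: m_ac flip: nat_pow_mult)
      finally have "a = y [^] (i + 3) \<otimes> (k \<otimes> inv (y [^] (4::nat)))"
        using a y(1) Kc[OF k(1)] by (simp add: inv_solve_right flip: m_assoc)
      moreover have "k \<otimes> inv (y [^] (4::nat)) \<in> ?K"
        using y4[of 1] by (intro Km k(1) subgroup.m_inv_closed[OF K]) simp
      ultimately show ?thesis by blast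
    qed (use cover_even a in blast)
    obtain \<chi>\<^sub>4 where \<chi>\<^sub>4: "char_mod G 4 \<chi>\<^sub>4" "[\<chi>\<^sub>4 y = 1] (mod 4)"
      using char_mod_of_generator[OF K y(1) _ yK cover] by auto
    have "(4::nat) choose 2 = 6" by (simp add: numeral_eq_Suc)
    then show ?thesis
      using twist_by_choose_two[OF fin two_is_prime_nat, of 3 4 \<chi>\<^sub>4 y] eight \<chi>\<^sub>4 y(1) by simp
  qed
qed

section \<open>The orders of the theorem\<close>

lemma order_form_iff:
  fixes n :: nat assumes "n > 0"
  shows "(\<exists>\<delta> \<in> {0, 1, 2 :: nat}. \<exists>P :: nat set. finite P \<and>
       (\<forall>p \<in> P. Factorial_Ring.prime p \<and> odd p) \<and> n = 2 ^ \<delta> * \<Prod>P) \<longleftrightarrow>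
     \<not> 8 dvd n \<and> (\<forall>p. Factorial_Ring.prime p \<longrightarrow> odd p \<longrightarrow> \<not> p ^ 2 dvd n)" (is "?l \<longleftrightarrow> ?r")
proof
  assume ?l
  then obtain \<delta> P where d: "\<delta> \<in> {0,1,2}" and P: "finite P" "\<forall>p\<in>P. Factorial_Ring.prime p \<and> odd p"
    and n: "n = 2 ^ \<delta> * \<Prod>P" by blast
  have oddP: "odd (\<Prod>P)" using P by (simp add: even_prod_iff)
  have "\<not> 8 dvd n"
  proof
    assume "8 dvd n"
    then have "2 ^ 3 dvd 2 ^ \<delta> * \<Prod>P" by (simp add: n)
    moreover have "coprime (2 ^ 3) (\<Prod>P)" using oddP by (simp only: coprime_power_left_iff coprime_left_2_iff_odd) simp
    ultimately have "2 ^ 3 dvd (2::nat) ^ \<delta>" by (metis coprime_dvd_mult_left_iff)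
    then show False using d by auto
  qed
  moreover have "\<not> p ^ 2 dvd n" if p: "Factorial_Ring.prime p" "odd p" for p
  proof
    assume "p ^ 2 dvd n"
    moreover have "coprime (p ^ 2) (2 ^ \<delta>)" using p by simp
    ultimately have sq: "p ^ 2 dvd \<Prod>P" unfolding n by (metis coprime_dvd_mult_right_iff)
    then have "p dvd \<Prod>P" by (metis dvd_trans dvd_triv_left power2_eq_square)
    then obtain r where "r \<in> P" "p dvd r" using p(1) P(1) by (auto simp: prime_dvd_prod_iff)
    then have "p \<in> P" using P(2) p(1) primes_dvd_imp_eq by blast
    then have "\<Prod>P = p * \<Prod>(P - {p})" using P(1) by (simp add: prod.remove)
    then have "p * p dvd p * \<Prod>(P - {p})" using sq by (simp add: power2_eq_square)
    then have "p dvd \<Prod>(P - {p})" using prime_gt_0_nat[OF p(1)] by simp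
    then obtain r where "r \<in> P" "r \<noteq> p" "p dvd r" using p(1) P(1) by (auto simp: prime_dvd_prod_iff)
    then show False using P(2) p(1) primes_dvd_imp_eq by blast
  qed
  ultimately show ?r by blast
next
  assume r: ?r
  let ?P = "prime_factors n - {2}"
  have mult: "multiplicity p n = 1" if "p \<in> ?P" for p
  proof -
    have p: "Factorial_Ring.prime p" "p dvd n" "p \<noteq> 2" using that by (auto simp: in_prime_factors_iff)
    then have "odd p" using primes_dvd_imp_eq[OF two_is_prime_nat p(1)] by auto
    then have "\<not> p ^ 2 dvd n" using r p(1) by blast
    then have "multiplicity p n < 2" using assms p(1) by (metis multiplicity_dvd' not_less)
    moreover have "multiplicity p n > 0" using that by (simp add: prime_factors_multiplicity)
    ultimately show ?thesis by simp
  qed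
  have "multiplicity 2 n < 3"
  proof (rule ccontr)
    assume "\<not> multiplicity 2 n < 3"
    then have "2 ^ 3 dvd n" by (metis multiplicity_dvd' not_less)
    then show False using r by simp
  qed
  have "n = (\<Prod>p\<in>prime_factors n. p ^ multiplicity p n)" using assms by (simp add: prime_factorization_nat)
  also have "\<dots> = (\<Prod>p\<in>insert 2 (prime_factors n). p ^ multiplicity p n)"
    by (rule prod.mono_neutral_left) (simp, blast, auto simp: prime_factors_multiplicity)
  also have "\<dots> = 2 ^ multiplicity 2 n * (\<Prod>p\<in>?P. p ^ multiplicity p n)"
    by (subst prod.insert_remove) auto
  also have "(\<Prod>p\<in>?P. p ^ multiplicity p n) = \<Prod>?P"
    using mult by (intro prod.cong) auto
  finally have "n = 2 ^ multiplicity 2 n * \<Prod>?P" .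
  moreover have "multiplicity 2 n \<in> {0,1,2}" using \<open>multiplicity 2 n < 3\<close> by auto
  moreover have "Factorial_Ring.prime p \<and> odd p" if "p \<in> ?P" for p
    using that primes_dvd_imp_eq[OF two_is_prime_nat, of p] by (auto simp: in_prime_factors_iff)
  moreover have "finite ?P" by simp
  ultimately show ?l by blast
qed

theorem theorem1p2:
  fixes A :: "('a, 'm) monoid_scheme"
  assumes "comm_group A" and "finite (carrier A)"
  shows "e_count A A = 1 \<longleftrightarrow>
    (\<exists>\<delta> \<in> {0, 1, 2 :: nat}. \<exists>P :: nat set. finite P \<and>
       (\<forall>p \<in> P. Factorial_Ring.prime p \<and> odd p) \<and>
       card (carrier A) = 2 ^ \<delta> * \<Prod>P)"
proof -
  interpret comm_group A by (rule assms(1))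
  note fin = assms(2)
  have "card (carrier A) > 0" using fin by (auto simp: card_gt_0_iff)
  note form = order_form_iff[OF this]
  show ?thesis
    unfolding form
  proof
    assume "e_count A A = 1"
    then show "\<not> 8 dvd card (carrier A) \<and>
        (\<forall>p. Factorial_Ring.prime p \<longrightarrow> odd p \<longrightarrow> \<not> p ^ 2 dvd card (carrier A))"
      using eight_twist[OF fin] odd_square_twist[OF fin] by (auto simp: order_def)
  next
    assume "\<not> 8 dvd card (carrier A) \<and>
        (\<forall>p. Factorial_Ring.prime p \<longrightarrow> odd p \<longrightarrow> \<not> p ^ 2 dvd card (carrier A))"
    then have "{R. regular_subgroup A R \<and> (Perm A)\<lparr>carrier := R\<rparr> \<cong> A \<and> normalized_by_left_reg A R}
        = {left_reg A ` carrier A}"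
      using regular_normalized_imp_left_reg[OF fin] left_reg_counted by blast
    then show "e_count A A = 1" by (simp add: e_count_def)
  qed
qed

end
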